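(* Let $\mu$ be a non-negative Radon measure on $\mathbb{R}^d$. Then $$W^{1,1}_{\mathrm{Lip}}(\mathbb{R}^d,\mu)\subseteq W^{1,1}(\mathbb{R}^d,\mu).$$ Moreover, $|\nabla_\mu f|\le|\nabla f|_{rs}$ holds $\mu$-a.e. for every $f\in W^{1,1}_{\mathrm{Lip}}(\mathbb{R}^d,\mu)$.
   Context: $\mathrm{LIP}_c(\mathbb{R}^d)$ is the space of compactly supported real-valued Lipschitz functions on $\mathbb{R}^d$. $\mathrm{Lip}(f;E)$ is the Lipschitz constant of $f|_E$, and $\mathrm{lip}_a(f)(x):=\lim_{r\to0}\mathrm{Lip}(f;B_r(x))$. Relaxed slopes: a non-negative $G\in L^1_\mu(\mathbb{R}^d)$ is a relaxed slope of $f\in L^1_\mu(\mathbb{R}^d)$ if there are $(f_n)_n\subseteq\mathrm{LIP}_c(\mathbb{R}^d)$ and $G'\in L^1_\mu(\mathbb{R}^d)$ with $f_n\to f$ strongly in $L^1_\mu(\mathbb{R}^d)$, $\mathrm{lip}_a(f_n)\rightharpoonup G'$ weakly in $L^1_\mu(\mathbb{R}^d)$, and $G'\le G$ $\mu$-a.e. $W^{1,1}_{\mathrm{Lip}}(\mathbb{R}^d,\mu)$ is the set of $f\in L^1_\mu(\mathbb{R}^d)$ having at least one relaxed slope; for such $f$, $|\nabla f|_{rs}$ denotes the $\mu$-a.e. minimal relaxed slope (which exists). Tangential gradient: $\mathrm{D}_\infty(\mathrm{div}_\mu)$ is the set of $v\in L^\infty_\mu(\mathbb{R}^d;\mathbb{R}^d)$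 for which there exists $\mathrm{div}_\mu(v)\in L^\infty_\mu(\mathbb{R}^d)$ with $\int\nabla f\cdot v\,d\mu=-\int f\,\mathrm{div}_\mu(v)\,d\mu$ for all $f\in C^\infty_c(\mathbb{R}^d)$. A bundle in $\mathbb{R}^d$ is a map $V$ assigning to each $x$ a linear subspace $V(x)\subseteq\mathbb{R}^d$ with $x\mapsto\mathrm{dist}(y,V(x))$ Borel for every $y\in\mathbb{R}^d$. $T_\mu$ is the ($\mu$-a.e. unique) minimal bundle such that every $v\in\mathrm{D}_\infty(\mathrm{div}_\mu)$ satisfies $v(x)\in T_\mu(x)$ for $\mu$-a.e. $x$ (minimal: $T_\mu(x)\subseteq S(x)$ for $\mu$-a.e. $x$ for any other bundle $S$ with this property). $\Gamma^1_\mu(T_\mu)$ is the space of $v\in L^1_\mu(\mathbb{R}^d;\mathbb{R}^d)$ with $v(x)\in T_\mu(x)$ for $\mu$-a.e. $x$. For $f\in C^\infty_c(\mathbb{R}^d)$, $\nabla_\mu f(x):=\mathrm{pr}_{T_\mu(x)}(\nabla f(x))$ (orthogonal projection). $W^{1,1}(\mathbb{R}^d,\mu)$ is the completion of $C^\infty_c(\mathbb{R}^d)$ under $\|f\|_{L^1_\mu}+\|\nabla_\mu f\|_{L^1_\mu}$; since $\nabla_\mu$ is closable, it is identified with the set of $f\in L^1_\mu(\mathbb{R}^d)$ for which there are $f_n\in C^\infty_c(\mathbb{R}^d)$ and $w\in\Gamma^1_\mu(T_\mu)$ with $f_n\to f$ in $L^1_\mu$ and $\nabla_\mu f_n\to w$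 in $L^1_\mu(\mathbb{R}^d;\mathbb{R}^d)$; such $w$ is unique and is denoted $\nabla_\mu f$. *)

theory Defs
  imports "HOL-Analysis.Analysis"
begin

text \<open>
  Elements of Lebesgue spaces are represented by measurable functions; everything below that refers
  to such an element is stated up to \<^term>\<open>\<mu>\<close>-null sets.
\<close>

text \<open>On a Euclidean space a Borel measure that is finite on compact sets is automatically regular.\<close>

definition radon_measure :: "'a::euclidean_space measure \<Rightarrow> bool" where
  "radon_measure \<mu> \<longleftrightarrow> sets \<mu> = sets borel \<and> (\<forall>K. compact K \<longrightarrow> emeasure \<mu> K < \<infinity>)"

definition essentially_bounded ::
    "'a measure \<Rightarrow> ('a \<Rightarrow> 'b::{second_countable_topology, real_normed_vector}) \<Rightarrow> bool" where
  "essentially_bounded \<mu> v \<longleftrightarrow> v \<in> borel_measurable \<mu> \<and> (\<exists>C. AE x in \<mu>. norm (v x) \<le> C)"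

definition L1_converges ::
    "'a measure \<Rightarrow> (nat \<Rightarrow> 'a \<Rightarrow> 'b::{second_countable_topology, banach}) \<Rightarrow> ('a \<Rightarrow> 'b) \<Rightarrow> bool" where
  "L1_converges \<mu> F f \<longleftrightarrow>
     (\<forall>n. integrable \<mu> (F n)) \<and> integrable \<mu> f \<and>
     (\<lambda>n. \<integral>x. norm (F n x - f x) \<partial>\<mu>) \<longlonglongrightarrow> 0"

text \<open>
  Continuous linear functionals on \<open>L\<^sup>1\<close>, as functions on representatives. The bound
  makes the value independent of the representative; values at non-integrable functions are
  irrelevant.
\<close>

definition L1_functional :: "'a measure \<Rightarrow> (('a \<Rightarrow> real) \<Rightarrow> real) \<Rightarrow> bool" where
  "L1_functional \<mu> \<phi> \<longleftrightarrow>
     (\<forall>f g. integrable \<mu> f \<longrightarrow> integrable \<mu> g \<longrightarrow> \<phi> (\<lambda>x. f x + g x) = \<phi> f + \<phi> g) \<and>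
     (\<forall>c f. integrable \<mu> f \<longrightarrow> \<phi> (\<lambda>x. c * f x) = c * \<phi> f) \<and>
     (\<exists>C. \<forall>f. integrable \<mu> f \<longrightarrow> \<bar>\<phi> f\<bar> \<le> C * (\<integral>x. \<bar>f x\<bar> \<partial>\<mu>))"

definition L1_converges_weakly ::
    "'a measure \<Rightarrow> (nat \<Rightarrow> 'a \<Rightarrow> real) \<Rightarrow> ('a \<Rightarrow> real) \<Rightarrow> bool" where
  "L1_converges_weakly \<mu> F f \<longleftrightarrow>
     (\<forall>n. integrable \<mu> (F n)) \<and> integrable \<mu> f \<and>
     (\<forall>\<phi>. L1_functional \<mu> \<phi> \<longrightarrow> (\<lambda>n. \<phi> (F n)) \<longlonglongrightarrow> \<phi> f)"

definition compactly_supported :: "('a::euclidean_space \<Rightarrow> real) \<Rightarrow> bool" where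
  "compactly_supported f \<longleftrightarrow> compact (closure {x. f x \<noteq> 0})"

definition LIP_c :: "('a::euclidean_space \<Rightarrow> real) set" where
  "LIP_c = {f. compactly_supported f \<and> (\<exists>C. C-lipschitz_on UNIV f)}"

text \<open>The least Lipschitz constant; meaningful only if \<open>f\<close> is Lipschitz on \<open>E\<close>.\<close>

definition Lip :: "('a::euclidean_space \<Rightarrow> real) \<Rightarrow> 'a set \<Rightarrow> real" where
  "Lip f E = Inf {C. C-lipschitz_on E f}"

definition lip_a :: "('a::euclidean_space \<Rightarrow> real) \<Rightarrow> 'a \<Rightarrow> real" where
  "lip_a f x = Lim (at_right 0) (\<lambda>r. Lip f (ball x r))"

definition relaxed_slope ::
    "'a::euclidean_space measure \<Rightarrow> ('a \<Rightarrow> real) \<Rightarrow> ('a \<Rightarrow> real) \<Rightarrow> bool" where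
  "relaxed_slope \<mu> f G \<longleftrightarrow>
     integrable \<mu> G \<and> (AE x in \<mu>. 0 \<le> G x) \<and>
     (\<exists>F G'. (\<forall>n. F n \<in> LIP_c) \<and> L1_converges \<mu> F f \<and>
        L1_converges_weakly \<mu> (\<lambda>n. lip_a (F n)) G' \<and> (AE x in \<mu>. G' x \<le> G x))"

definition W11_Lip :: "'a::euclidean_space measure \<Rightarrow> ('a \<Rightarrow> real) set" where
  "W11_Lip \<mu> = {f. integrable \<mu> f \<and> (\<exists>G. relaxed_slope \<mu> f G)}"

text \<open>\<open>G\<close> is a representative of \<open>|\<nabla>f|\<^sub>r\<^sub>s\<close>.\<close>

definition minimal_relaxed_slope ::
    "'a::euclidean_space measure \<Rightarrow> ('a \<Rightarrow> real) \<Rightarrow> ('a \<Rightarrow> real) \<Rightarrow> bool" where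
  "minimal_relaxed_slope \<mu> f G \<longleftrightarrow>
     relaxed_slope \<mu> f G \<and> (\<forall>H. relaxed_slope \<mu> f H \<longrightarrow> (AE x in \<mu>. G x \<le> H x))"

primrec C_k :: "nat \<Rightarrow> ('a::euclidean_space \<Rightarrow> real) \<Rightarrow> bool" where
  "C_k 0 f \<longleftrightarrow> continuous_on UNIV f"
| "C_k (Suc k) f \<longleftrightarrow>
     (\<forall>x. f differentiable (at x)) \<and> (\<forall>v. C_k k (\<lambda>x. frechet_derivative f (at x) v))"

definition Cinf_c :: "('a::euclidean_space \<Rightarrow> real) set" where
  "Cinf_c = {f. (\<forall>k. C_k k f) \<and> compactly_supported f}"

definition grad :: "('a::euclidean_space \<Rightarrow> real) \<Rightarrow> 'a \<Rightarrow> 'a" where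
  "grad f x = (THE D. GDERIV f x :> D)"

definition D_inf_div :: "'a::euclidean_space measure \<Rightarrow> ('a \<Rightarrow> 'a) set" where
  "D_inf_div \<mu> = {v. essentially_bounded \<mu> v \<and>
     (\<exists>g :: 'a \<Rightarrow> real. essentially_bounded \<mu> g \<and>
        (\<forall>f\<in>Cinf_c. (\<integral>x. grad f x \<bullet> v x \<partial>\<mu>) = - (\<integral>x. f x * g x \<partial>\<mu>)))}"

definition linear_bundle :: "('a::euclidean_space \<Rightarrow> 'a set) \<Rightarrow> bool" where
  "linear_bundle V \<longleftrightarrow>
     (\<forall>x. subspace (V x)) \<and> (\<forall>y. (\<lambda>x. infdist y (V x)) \<in> borel_measurable borel)"

definition carries_D_inf_div ::
    "'a::euclidean_space measure \<Rightarrow> ('a \<Rightarrow> 'a set) \<Rightarrow> bool" where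
  "carries_D_inf_div \<mu> V \<longleftrightarrow>
     linear_bundle V \<and> (\<forall>v\<in>D_inf_div \<mu>. AE x in \<mu>. v x \<in> V x)"

text \<open>\<open>T\<close> is a version of the (\<open>\<mu>\<close>-a.e. unique) tangent bundle \<open>T\<^sub>\<mu>\<close>.\<close>

definition tangent_bundle ::
    "'a::euclidean_space measure \<Rightarrow> ('a \<Rightarrow> 'a set) \<Rightarrow> bool" where
  "tangent_bundle \<mu> T \<longleftrightarrow>
     carries_D_inf_div \<mu> T \<and>
     (\<forall>S. carries_D_inf_div \<mu> S \<longrightarrow> (AE x in \<mu>. T x \<subseteq> S x))"

definition L1_sections ::
    "'a::euclidean_space measure \<Rightarrow> ('a \<Rightarrow> 'a set) \<Rightarrow> ('a \<Rightarrow> 'a) set" where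
  "L1_sections \<mu> T = {w. integrable \<mu> w \<and> (AE x in \<mu>. w x \<in> T x)}"

definition orth_proj :: "'a::euclidean_space set \<Rightarrow> 'a \<Rightarrow> 'a" where
  "orth_proj S y = (THE p. p \<in> S \<and> (\<forall>z\<in>S. orthogonal (y - p) z))"

definition smooth_tangential_grad ::
    "('a::euclidean_space \<Rightarrow> 'a set) \<Rightarrow> ('a \<Rightarrow> real) \<Rightarrow> 'a \<Rightarrow> 'a" where
  "smooth_tangential_grad T f x = orth_proj (T x) (grad f x)"

text \<open>
  With \<open>T = T\<^sub>\<mu>\<close>: \<open>f \<in> W\<^sup>1\<^sup>,\<^sup>1(\<mu>)\<close> and \<open>w\<close> is a representative of \<open>\<nabla>\<^sub>\<mu> f\<close>.
\<close>

definition tangential_gradient ::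
    "'a::euclidean_space measure \<Rightarrow> ('a \<Rightarrow> 'a set) \<Rightarrow> ('a \<Rightarrow> real) \<Rightarrow> ('a \<Rightarrow> 'a) \<Rightarrow> bool" where
  "tangential_gradient \<mu> T f w \<longleftrightarrow>
     w \<in> L1_sections \<mu> T \<and>
     (\<exists>F. (\<forall>n. F n \<in> Cinf_c) \<and> L1_converges \<mu> F f \<and>
        L1_converges \<mu> (\<lambda>n. smooth_tangential_grad T (F n)) w)"

definition W11 :: "'a::euclidean_space measure \<Rightarrow> ('a \<Rightarrow> 'a set) \<Rightarrow> ('a \<Rightarrow> real) set" where
  "W11 \<mu> T = {f. integrable \<mu> f \<and> (\<exists>w. tangential_gradient \<mu> T f w)}"

end

(*
  Mollifying LIP_c functions shows that lip_a (F n) is an L^1 limit of functions dominating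
  |grad g| with g in Cinf_c close to F n. By Hahn-Banach, convex combinations turn the weak limit G'
  into a strong one, so there are g_k -> f in L^1 with |grad g_k| <= h_k -> G' in L^1. The projected
  gradients are then H b_k + o(1) in L^1 with H = max 0 G' and |b_k| <= 1. Choosing the pairs
  (g_k, b_k) almost minimal for the quadratic energy of b with weight H makes H b_k Cauchy in L^1 by
  the parallelogram law. Its limit w satisfies |w| <= H and is a tangential gradient of f.

  Uniqueness of w: the difference z of two candidates is orthogonal in the integral sense to every
  phi v with phi in Cinf_c and v in D_inf_div, hence z is orthogonal to v almost everywhere. So the
  orthogonal complement of z in T also carries D_inf_div, and minimality of T forces z = 0.
*)
theory Submission
  imports Defs "HOL-Computational_Algebra.Polynomial"
begin

section \<open>Smooth functions and gradients\<close>

text \<open>The difficulty is the exponent 1: \<open>L\<^sup>1\<close> is not reflexive, so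
  gradients bounded in \<open>L\<^sup>1\<close> need not have a weakly convergent subsequence, while
  \<open>W11\<close> asks for strong convergence. What helps is that the dominating functions
  converge strongly to the integrable \<open>H\<close>. Dividing a gradient by its dominating
  function leaves a field in the unit ball of the Hilbert space \<open>L\<^sup>2\<close> with weight
  \<open>H\<close>. Multiplication by \<open>H\<close> maps this space continuously into
  \<open>L\<^sup>1\<close>, because \<open>H\<close> is integrable. Nearly minimal elements of a
  decreasing family of convex sets are Cauchy in a Hilbert space, so no weak compactness of
  Dunford-Pettis type is invoked. Convexity of these sets rests on the linearity of the gradient and
  of the projection onto a fixed subspace.

  Uniqueness is proved separately because the theorem speaks about every tangential gradient,
  whereas the construction bounds the one that it produces.\<close>

lemma C_k_continuous_on: "C_k k f \<Longrightarrow> continuous_on UNIV f"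
  by (cases k) (auto simp: differentiable_imp_continuous_within continuous_on_eq_continuous_at)

lemma C_k_Suc_imp: "C_k (Suc k) f \<Longrightarrow> C_k k f"
proof (induction k arbitrary: f)
  case 0
  then show ?case using C_k_continuous_on by (metis C_k.simps(1))
qed auto

lemma C_k_const: "C_k k (\<lambda>x. c)"
  by (induction k arbitrary: c) auto

lemma C_k_inner: "C_k k (\<lambda>x. x \<bullet> a)"
proof (cases k)
  case (Suc j)
  have "((\<lambda>x. x \<bullet> a) has_derivative (\<lambda>v. v \<bullet> a)) (at x)" for x
    by (auto intro!: derivative_eq_intros)
  note D = this
  have "frechet_derivative (\<lambda>x. x \<bullet> a) (at x) = (\<lambda>v. v \<bullet> a)" for x
    by (intro frechet_derivative_at[symmetric] D)
  then show ?thesis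
    using Suc D differentiableI by (auto simp: C_k_const)
qed (auto intro!: continuous_intros)

lemma C_k_add:
  assumes "C_k k f" "C_k k g"
  shows "C_k k (\<lambda>x. f x + g x)"
  using assms
proof (induction k arbitrary: f g)
  case (Suc k)
  have "frechet_derivative (\<lambda>x. f x + g x) (at x) =
      (\<lambda>v. frechet_derivative f (at x) v + frechet_derivative g (at x) v)" for x
    using Suc.prems by (intro frechet_derivative_at[symmetric] has_derivative_add)
      (auto simp: frechet_derivative_works)
  then show ?case
    using Suc by (auto intro!: differentiable_add)
qed (auto intro: continuous_intros)

lemma C_k_mult:
  assumes "C_k k f" "C_k k g"
  shows "C_k k (\<lambda>x. f x * g x)"
  using assms
proof (induction k arbitrary: f g)
  case (Suc k)
  have "frechet_derivative (\<lambda>x. f x * g x) (at x) =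
      (\<lambda>v. f x * frechet_derivative g (at x) v + frechet_derivative f (at x) v * g x)" for x
    using Suc.prems by (intro frechet_derivative_at[symmetric] has_derivative_mult)
      (auto simp: frechet_derivative_works)
  moreover have "C_k k f" "C_k k g"
    using Suc.prems C_k_Suc_imp by blast+
  ultimately show ?case
    using Suc by (auto intro!: differentiable_mult C_k_add)
qed (auto intro: continuous_intros)

lemma C_k_uminus: "C_k k f \<Longrightarrow> C_k k (\<lambda>x. - f x)"
  using C_k_mult[OF C_k_const[of k "-1"], of f] by simp

lemma compactly_supported_iff:
  fixes f :: "'a::euclidean_space \<Rightarrow> real"
  shows "compactly_supported f \<longleftrightarrow> bounded {x. f x \<noteq> 0}"
  unfolding compactly_supported_def by simp

lemma Cinf_cD: "f \<in> Cinf_c \<Longrightarrow> C_k k f" "f \<in> Cinf_c \<Longrightarrow> compactly_supported f"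
  by (auto simp: Cinf_c_def)

lemma Cinf_c_add:
  assumes "f \<in> Cinf_c" "g \<in> Cinf_c"
  shows "(\<lambda>x. f x + g x) \<in> Cinf_c"
proof -
  have "bounded ({x. f x \<noteq> 0} \<union> {x. g x \<noteq> 0})"
    using assms by (auto simp: Cinf_c_def compactly_supported_iff)
  then have "bounded {x. f x + g x \<noteq> 0}"
    by (rule bounded_subset) auto
  then show ?thesis
    using assms by (auto simp: Cinf_c_def compactly_supported_iff C_k_add)
qed

lemma Cinf_c_mult:
  assumes "f \<in> Cinf_c" "\<And>k. C_k k g"
  shows "(\<lambda>x. g x * f x) \<in> Cinf_c"
proof -
  have "bounded {x. f x \<noteq> 0}"
    using assms by (auto simp: Cinf_c_def compactly_supported_iff)
  then have "bounded {x. g x * f x \<noteq> 0}"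
    by (rule bounded_subset) auto
  then show ?thesis
    using assms by (auto simp: Cinf_c_def compactly_supported_iff C_k_mult)
qed

lemma Cinf_c_scale: "f \<in> Cinf_c \<Longrightarrow> (\<lambda>x. c * f x) \<in> Cinf_c"
  using Cinf_c_mult C_k_const by blast

lemma Cinf_c_diff: "f \<in> Cinf_c \<Longrightarrow> g \<in> Cinf_c \<Longrightarrow> (\<lambda>x. f x - g x) \<in> Cinf_c"
  using Cinf_c_add[of f "\<lambda>x. (-1) * g x"] Cinf_c_scale[of g "-1"] by simp

lemma grad_eqI:
  assumes "GDERIV f x :> D"
  shows "grad f x = D"
  unfolding grad_def
proof (rule the_equality[where P = "\<lambda>D. GDERIV f x :> D", OF assms])
  fix E assume "GDERIV f x :> E"
  then have "(\<lambda>h. h \<bullet> E) = (\<lambda>h. h \<bullet> D)"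
    using has_derivative_unique[of f _ x] assms unfolding gderiv_def by blast
  then show "E = D"
    by (metis vector_eq_ldot)
qed

text \<open>Riesz representation in coordinates: a linear functional is the inner product with the
  vector built from its values on \<open>Basis\<close>. This makes the \<open>THE\<close> in
  \<open>grad\<close> well defined for these functions.\<close>

lemma GDERIV_grad:
  assumes "C_k (Suc k) f"
  shows "GDERIV f x :> grad f x"
proof -
  let ?D = "frechet_derivative f (at x)"
  have D: "(f has_derivative ?D) (at x)"
    using assms by (simp add: frechet_derivative_works)
  interpret linear ?D
    using D has_derivative_linear by blast
  have "?D v = v \<bullet> (\<Sum>b\<in>Basis. ?D b *\<^sub>R b)" for v
  proof -
    have "?D v = (\<Sum>b\<in>Basis. (v \<bullet> b) * ?D b)"
      by (subst euclidean_representation[of v, symmetric]) (simp add: sum scale)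
    then show ?thesis
      by (simp add: inner_sum_right mult.commute)
  qed
  then have "?D = (\<lambda>v. v \<bullet> (\<Sum>b\<in>Basis. ?D b *\<^sub>R b))"
    by (rule ext)
  with D have "GDERIV f x :> (\<Sum>b\<in>Basis. ?D b *\<^sub>R b)"
    unfolding gderiv_def by (rule back_subst)
  then show ?thesis
    by (simp add: grad_eqI)
qed

lemma grad_inner:
  assumes "C_k (Suc k) f"
  shows "grad f x \<bullet> v = frechet_derivative f (at x) v"
proof -
  have "(\<lambda>h. h \<bullet> grad f x) = frechet_derivative f (at x)"
    using GDERIV_grad[OF assms] unfolding gderiv_def by (rule frechet_derivative_at)
  then show ?thesis
    by (metis inner_commute)
qed

lemma continuous_on_grad:
  assumes "C_k (Suc k) f"
  shows "continuous_on UNIV (grad f)"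
proof -
  have "continuous_on UNIV (\<lambda>x. grad f x \<bullet> v)" for v
    using assms by (auto simp: grad_inner[OF assms] intro!: C_k_continuous_on[of k])
  then show ?thesis
    by (subst continuous_on_componentwise) auto
qed

lemma grad_eq_0:
  assumes "C_k (Suc k) f" "x \<notin> closure {x. f x \<noteq> 0}"
  shows "grad f x = 0"
proof -
  have "((\<lambda>x. 0) has_derivative (\<lambda>h. h \<bullet> 0)) (at x)"
    by simp
  moreover have "open (- closure {x. f x \<noteq> 0})" "x \<in> - closure {x. f x \<noteq> 0}"
    using assms(2) by (auto simp only: open_Compl closed_closure Compl_iff)
  moreover have "0 = f y" if "y \<in> - closure {x. f x \<noteq> 0}" for y
    using that closure_subset[of "{x. f x \<noteq> 0}"] by (simp add: subset_iff) metis
  ultimately have "GDERIV f x :> 0"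
    unfolding gderiv_def using has_derivative_transform_within_open by blast
  then show ?thesis
    by (rule grad_eqI)
qed

lemma grad_add:
  assumes "C_k (Suc k) f" "C_k (Suc k) g"
  shows "grad (\<lambda>x. f x + g x) x = grad f x + grad g x"
  by (intro grad_eqI GDERIV_add GDERIV_grad[OF assms(1)] GDERIV_grad[OF assms(2)])

lemma grad_mult:
  assumes "C_k (Suc k) f" "C_k (Suc k) g"
  shows "grad (\<lambda>x. f x * g x) x = f x *\<^sub>R grad g x + g x *\<^sub>R grad f x"
  by (intro grad_eqI GDERIV_mult GDERIV_grad[OF assms(1)] GDERIV_grad[OF assms(2)])

lemma grad_scale:
  assumes "C_k (Suc k) f"
  shows "grad (\<lambda>x. c * f x) x = c *\<^sub>R grad f x"
  using GDERIV_mult[OF GDERIV_const GDERIV_grad[OF assms], of c x] by (simp add: grad_eqI)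

lemma grad_diff:
  assumes "C_k (Suc k) f" "C_k (Suc k) g"
  shows "grad (\<lambda>x. f x - g x) x = grad f x - grad g x"
  by (intro grad_eqI GDERIV_diff GDERIV_grad[OF assms(1)] GDERIV_grad[OF assms(2)])

text \<open>In the direction of its gradient the function grows at rate
  \<open>norm (grad f x)\<close>, which the Lipschitz bound centred at \<open>x\<close> forbids to
  exceed \<open>L\<close>.\<close>

lemma norm_grad_le:
  assumes f: "C_k (Suc k) f" and d: "d > 0" and L: "0 \<le> L"
    and lip: "\<And>y. dist y x < d \<Longrightarrow> \<bar>f y - f x\<bar> \<le> L * dist y x"
  shows "norm (grad f x) \<le> L"
proof (rule ccontr)
  define D where "D = grad f x"
  assume "\<not> norm (grad f x) \<le> L"
  then have D: "norm D > L" "norm D > 0"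
    using L by (auto simp: D_def)
  have der: "(f has_derivative (\<lambda>h. h \<bullet> D)) (at x)"
    using GDERIV_grad[OF f] by (simp add: gderiv_def D_def)
  \<comment> \<open>Half of the excess of \<open>norm D\<close> over \<open>L\<close>, so that
    \<open>L + e < norm D\<close> even after the linearisation error.\<close>
  define e where "e = (norm D - L) / 2"
  have "e > 0" using D by (simp add: e_def)
  with der obtain d' where d': "d' > 0"
    "\<And>y. norm (y - x) < d' \<Longrightarrow> norm (f y - f x - (y - x) \<bullet> D) \<le> e * norm (y - x)"
    unfolding has_derivative_at_alt by meson
  \<comment> \<open>The step along \<open>D\<close> has length \<open>min d d' / 2\<close>, inside
    both radii.\<close>
  define t where "t = min d d' / (2 * norm D)"
  have t: "t > 0" using d d' D by (simp add: t_def)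
  have nt: "norm (t *\<^sub>R D) = min d d' / 2"
    using D t d d' by (simp add: t_def)
  define y where "y = x + t *\<^sub>R D"
  have yx: "norm (y - x) = t * norm D" "norm (y - x) < d" "norm (y - x) < d'"
    using nt t d d' by (auto simp: y_def)
  have "(y - x) \<bullet> D = t * (norm D)\<^sup>2"
    by (simp add: y_def power2_norm_eq_inner)
  moreover have "\<bar>f y - f x\<bar> \<le> L * (t * norm D)"
    using lip[of y] yx by (simp add: dist_norm)
  moreover have "\<bar>f y - f x - (y - x) \<bullet> D\<bar> \<le> e * (t * norm D)"
    using d'(2)[of y] yx by simp
  ultimately have "t * (norm D)\<^sup>2 \<le> L * (t * norm D) + e * (t * norm D)"
    by linarith
  then have "(t * norm D) * norm D \<le> (t * norm D) * (L + e)"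
    by (simp add: algebra_simps power2_eq_square)
  then have "norm D \<le> L + e"
    using t D by (simp add: mult_le_cancel_left)
  then show False
    using D unfolding e_def by argo
qed

section \<open>A smooth bump function from exp(-1/t)\<close>

text \<open>The class of these functions is closed under differentiation, and they are smooth at \<open>0\<close>.\<close>

definition flat :: "real poly \<Rightarrow> real \<Rightarrow> real" where
  "flat p t = (if t > 0 then poly p (1 / t) * exp (- (1 / t)) else 0)"

lemma poly_exp_tendsto_0: "((\<lambda>s::real. poly p s * exp (- s)) \<longlongrightarrow> 0) at_top"
proof -
  have "((\<lambda>s::real. \<Sum>i\<le>degree p. coeff p i * (s ^ i / exp s)) \<longlongrightarrow> (\<Sum>i\<le>degree p. coeff p i * 0)) at_top"
    by (intro tendsto_intros tendsto_power_div_exp_0)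
  then show ?thesis
    by (simp add: poly_altdef sum_distrib_right exp_minus divide_inverse mult.assoc)
qed

lemma flat_tendsto_0: "(flat p \<longlongrightarrow> 0) (at 0)"
proof -
  have "((\<lambda>t. poly p (inverse t) * exp (- inverse t)) \<longlongrightarrow> 0) (at_right 0)"
    by (rule filterlim_compose[OF poly_exp_tendsto_0 filterlim_inverse_at_top_right])
  then have "(flat p \<longlongrightarrow> 0) (at_right 0)"
    by (rule Lim_transform_eventually)
      (auto simp: flat_def eventually_at_filter inverse_eq_divide)
  moreover have "(flat p \<longlongrightarrow> 0) (at_left 0)"
    by (rule Lim_transform_eventually[of "\<lambda>_. 0"])
      (auto simp: flat_def eventually_at_filter)
  ultimately show ?thesis
    by (simp add: filterlim_split_at)
qed

text \<open>With s = 1/t, differentiating p(s) exp(-s) in t gives s^2 (p(s) - p'(s)) exp(-s), whence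
  the factor \<open>[:0, 0, 1:]\<close>.\<close>

lemma flat_has_derivative:
  "(flat p has_real_derivative flat ([:0, 0, 1:] * (p - pderiv p)) t) (at t)"
proof (cases t "0::real" rule: linorder_cases)
  case less
  have "(flat p has_real_derivative 0) (at t)"
    by (rule has_field_derivative_transform_within_open[of "\<lambda>_. 0" _ _ "{..<0}"])
      (use less in \<open>auto simp: flat_def\<close>)
  then show ?thesis using less by (simp add: flat_def)
next
  case equal
  \<comment> \<open>The difference quotient at 0 is again a \<open>flat\<close> function, with the
    polynomial multiplied by the identity.\<close>
  have "((\<lambda>h. flat p h / h) \<longlongrightarrow> 0) (at 0)"
    by (rule Lim_transform_eventually[OF flat_tendsto_0[of "[:0, 1:] * p"]])
      (auto simp: flat_def eventually_at_filter)
  then show ?thesis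
    using equal by (simp add: DERIV_def flat_def)
next
  case greater
  have "((\<lambda>t. poly p (1 / t) * exp (- (1 / t))) has_real_derivative
      flat ([:0, 0, 1:] * (p - pderiv p)) t) (at t)"
    using greater
    by (auto intro!: derivative_eq_intros poly_DERIV[THEN DERIV_chain2]
        simp: flat_def field_simps power2_eq_square)
  then show ?thesis
    by (rule has_field_derivative_transform_within_open[where S = "{0<..}"])
      (use greater in \<open>auto simp: flat_def\<close>)
qed

text \<open>A directional derivative is another \<open>flat\<close> of the same inner function times
  a linear function; hence the induction lets \<open>p\<close> vary.\<close>

lemma C_k_flat_comp: "C_k k (\<lambda>x. flat p (c - x \<bullet> x))"
proof (induction k arbitrary: p)
  case 0
  have "isCont (flat p) t" for t
    using flat_has_derivative DERIV_isCont by blast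
  then have "continuous_on UNIV (flat p)"
    by (simp add: continuous_at_imp_continuous_on)
  then show ?case
    by (auto intro!: continuous_intros continuous_on_compose2[of UNIV "flat p"])
next
  case (Suc k)
  let ?q = "[:0, 0, 1:] * (p - pderiv p)"
  have D: "((\<lambda>x. flat p (c - x \<bullet> x)) has_derivative
      (\<lambda>v. flat ?q (c - x \<bullet> x) * (- (2 * (x \<bullet> v))))) (at x)" for x :: 'a
  proof -
    have "((\<lambda>x. c - x \<bullet> x) has_derivative (\<lambda>v. - (2 * (x \<bullet> v)))) (at x)"
      by (auto intro!: derivative_eq_intros simp: inner_commute)
    from has_derivative_compose[OF this flat_has_derivative[unfolded has_field_derivative_def]]
    show ?thesis .
  qed
  have "frechet_derivative (\<lambda>x. flat p (c - x \<bullet> x)) (at x) =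
      (\<lambda>v. flat ?q (c - x \<bullet> x) * (- 2 * (x \<bullet> v)))" for x :: 'a
    using frechet_derivative_at[OF D] by simp
  moreover have "C_k k (\<lambda>x::'a. flat ?q (c - x \<bullet> x) * (- 2 * (x \<bullet> v)))" for v
    by (intro C_k_mult Suc C_k_const C_k_inner)
  ultimately show ?case
    using D by (auto intro: differentiableI)
qed

section \<open>Mollification and the asymptotic Lipschitz constant\<close>

lemma radon_integrableI:
  fixes f :: "'a::euclidean_space \<Rightarrow> 'b::{banach, second_countable_topology}"
  assumes "radon_measure \<mu>" and f: "f \<in> borel_measurable borel"
    and K: "compact K" and le: "\<And>x. norm (f x) \<le> M * indicator K x"
  shows "integrable \<mu> f"
proof (rule Bochner_Integration.integrable_bound)
  have [measurable_cong]: "sets \<mu> = sets borel" and "emeasure \<mu> K < \<infinity>"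
    using assms by (auto simp: radon_measure_def)
  then show "integrable \<mu> (\<lambda>x. M * indicator K x :: real)"
    using K by (auto intro!: integrable_mult_right integrable_real_indicator borel_compact)
  show "f \<in> borel_measurable \<mu>"
    using f by measurable
  show "AE x in \<mu>. norm (f x) \<le> norm (M * indicator K x :: real)"
    using le abs_ge_self order_trans by (intro AE_I2) fastforce
qed

text \<open>Makes the integrability lemmas for Radon measures available for convolution
  integrals.\<close>

lemma radon_lborel: "radon_measure lborel"
  using emeasure_bounded_finite compact_imp_bounded by (auto simp: radon_measure_def)

lemma continuous_bounded_range:
  fixes f :: "'a::euclidean_space \<Rightarrow> 'b::euclidean_space"
  assumes f: "continuous_on UNIV f" and b: "bounded {x. f x \<noteq> 0}"
  obtains C where "\<And>x. norm (f x) \<le> C"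
proof -
  let ?K = "closure {x. f x \<noteq> 0}"
  have "bounded (f ` ?K)"
    using b f by (meson compact_closure compact_continuous_image compact_imp_bounded
        continuous_on_subset subset_UNIV)
  then obtain C where C: "\<And>x. x \<in> ?K \<Longrightarrow> norm (f x) \<le> C"
    by (auto simp: bounded_iff)
  have "norm (f x) \<le> max 0 C" for x
    using C[of x] closure_subset[of "{x. f x \<noteq> 0}"] by (cases "f x = 0") auto
  then show thesis by (rule that)
qed

lemma radon_integrable_continuous:
  fixes f :: "'a::euclidean_space \<Rightarrow> 'b::euclidean_space"
  assumes "radon_measure \<mu>" and f: "continuous_on UNIV f" and b: "bounded {x. f x \<noteq> 0}"
  shows "integrable \<mu> f"
proof -
  obtain C where "\<And>x. norm (f x) \<le> C"
    using continuous_bounded_range[OF f b] by blast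
  then have "norm (f x) \<le> C * indicator (closure {x. f x \<noteq> 0}) x" for x
    using closure_subset[of "{x. f x \<noteq> 0}"] order_trans[OF norm_ge_zero] by (cases "f x = 0") (auto simp: indicator_def)
  then show ?thesis
    using radon_integrableI[OF assms(1) borel_measurable_continuous_onI[OF f]] b
      compact_closure by blast
qed

text \<open>The radial function exp(-1/(r^2 - |x|^2)) on the ball, 0 outside, divided by its
  integral.\<close>

lemma bump_exists:
  assumes "r > 0"
  obtains \<rho> :: "'a::euclidean_space \<Rightarrow> real"
  where "\<rho> \<in> Cinf_c" "\<And>x. 0 \<le> \<rho> x" "\<And>x. \<rho> x \<noteq> 0 \<Longrightarrow> norm x < r" "integral\<^sup>L lborel \<rho> = 1"
proof -
  define \<psi> where "\<psi> = (\<lambda>x::'a. flat [:1:] (r\<^sup>2 - x \<bullet> x))"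
  have pos: "\<psi> x > 0" if "norm x < r" for x
    using that power_strict_mono[of "norm x" r 2] by (simp add: \<psi>_def flat_def power2_norm_eq_inner)
  have supp: "norm x < r" if "\<psi> x \<noteq> 0" for x
  proof -
    have "(norm x)\<^sup>2 < r\<^sup>2"
      using that by (simp add: \<psi>_def flat_def power2_norm_eq_inner split: if_splits)
    then show ?thesis
      using assms by (auto dest: power2_less_imp_less)
  qed
  have nonneg: "0 \<le> \<psi> x" for x
    by (simp add: \<psi>_def flat_def)
  have bd: "bounded {x. \<psi> x \<noteq> 0}"
    by (rule bounded_subset[of "ball 0 r"]) (auto dest: supp)
  then have smooth: "\<psi> \<in> Cinf_c"
    unfolding Cinf_c_def compactly_supported_iff using C_k_flat_comp by (auto simp: \<psi>_def)
  have int: "integrable lborel \<psi>"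
    using radon_integrable_continuous[OF radon_lborel C_k_continuous_on bd] Cinf_cD(1)[OF smooth]
    by blast
  \<comment> \<open>A vanishing integral would force the nonnegative \<open>\<psi>\<close> to vanish
    almost everywhere, against its positivity on a ball of positive volume.\<close>
  have "integral\<^sup>L lborel \<psi> \<noteq> 0"
  proof
    assume "integral\<^sup>L lborel \<psi> = 0"
    then have "AE x in lborel. \<psi> x = 0"
      using integral_nonneg_eq_0_iff_AE[OF int] nonneg by simp
    then have "AE x in lborel. \<not> x \<in> ball (0::'a) r"
    proof eventually_elim
      case (elim x)
      with pos[of x] show ?case by auto
    qed
    then have "emeasure lborel (ball (0::'a) r) = 0"
      by (subst (asm) AE_iff_measurable[where N = "ball 0 r"]) auto
    then show False
      using content_ball_pos[OF assms, of "0::'a"] by (simp add: measure_def)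
  qed
  then have I: "integral\<^sup>L lborel \<psi> > 0"
    using nonneg by (simp add: integral_nonneg order_less_le)
  let ?c = "1 / integral\<^sup>L lborel \<psi>"
  show thesis
    by (rule that[of "\<lambda>x. ?c * \<psi> x"]) (use I Cinf_c_scale[OF smooth, of ?c] nonneg supp in auto)
qed

section \<open>Convolution with a smooth kernel\<close>

text \<open>The derivative falls on the kernel, so continuity of \<open>f\<close> suffices; the
  minus sign is the inner derivative of \<open>y - x\<close>. The integral runs over a box to fit
  the Leibniz rule; in the mollification the box contains the support of \<open>f\<close>.\<close>

lemma convolution_has_derivative:
  fixes f \<rho> :: "'a::euclidean_space \<Rightarrow> real"
  assumes f: "continuous_on UNIV f" and \<rho>: "C_k (Suc k) \<rho>"
  shows "((\<lambda>x. integral (cbox a b) (\<lambda>y. f y * \<rho> (y - x))) has_derivative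
    (\<lambda>v. integral (cbox a b) (\<lambda>y. f y * (- frechet_derivative \<rho> (at (y - x)) v)))) (at x)"
proof -
  \<comment> \<open>The derivative in \<open>x\<close> is encoded as a bounded linear map, since the
    Leibniz rule asks for its joint continuity in \<open>x\<close> and \<open>y\<close>.\<close>
  define D where "D = (\<lambda>x y. (- f y) *\<^sub>R blinfun_inner_left (grad \<rho> (y - x)))"
  have cD: "continuous_on UNIV (\<lambda>(x, y). D x y)"
    unfolding D_def case_prod_beta
    by (intro continuous_intros bounded_linear.continuous_on[OF bounded_linear_blinfun_inner_left]
        continuous_on_compose2[OF continuous_on_grad[OF \<rho>]] continuous_on_compose2[OF f]) auto
  have c\<rho>: "continuous_on UNIV \<rho>"
    using \<rho> C_k_continuous_on by blast
  have der: "((\<lambda>x. f y * \<rho> (y - x)) has_derivative blinfun_apply (D x y)) (at x)" for x y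
  proof -
    have "(\<rho> has_derivative (\<lambda>h. h \<bullet> grad \<rho> (y - x))) (at (y - x))"
      using GDERIV_grad[OF \<rho>] by (simp add: gderiv_def)
    moreover have "((\<lambda>x. y - x) has_derivative (\<lambda>h. - h)) (at x)"
      by (auto intro!: derivative_eq_intros)
    ultimately have "((\<lambda>x. \<rho> (y - x)) has_derivative (\<lambda>h. (- h) \<bullet> grad \<rho> (y - x))) (at x)"
      using has_derivative_compose[of "\<lambda>x. y - x" "\<lambda>h. - h" x UNIV \<rho>] by blast
    then have "((\<lambda>x. f y * \<rho> (y - x)) has_derivative (\<lambda>h. f y * ((- h) \<bullet> grad \<rho> (y - x)))) (at x)"
      by (rule has_derivative_mult_right)
    moreover have "(\<lambda>h. f y * ((- h) \<bullet> grad \<rho> (y - x))) = blinfun_apply (D x y)"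
      by (auto simp: D_def scaleR_blinfun.rep_eq uminus_blinfun.rep_eq)
    ultimately show ?thesis by simp
  qed
  have "((\<lambda>x. integral (cbox a b) (\<lambda>y. f y * \<rho> (y - x))) has_derivative
      blinfun_apply (integral (cbox a b) (D x))) (at x within UNIV)"
    by (rule leibniz_rule[OF der[THEN has_derivative_at_withinI] _ continuous_on_subset[OF cD]])
      (auto intro!: integrable_continuous continuous_intros continuous_on_compose2[OF c\<rho>]
        continuous_on_subset[OF f])
  moreover have "D x integrable_on cbox a b"
    using continuous_on_compose2[OF cD continuous_on_Pair[OF continuous_on_const continuous_on_id]]
    by (intro integrable_continuous) auto
  then have "blinfun_apply (integral (cbox a b) (D x)) v =
      integral (cbox a b) (\<lambda>y. blinfun_apply (D x y) v)" for v
    by (rule blinfun_apply_integral)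
  then have "blinfun_apply (integral (cbox a b) (D x)) =
      (\<lambda>v. integral (cbox a b) (\<lambda>y. f y * (- frechet_derivative \<rho> (at (y - x)) v)))"
    by (simp add: fun_eq_iff D_def scaleR_blinfun.rep_eq uminus_blinfun.rep_eq grad_inner[OF \<rho>, symmetric] inner_commute)
  ultimately show ?thesis
    by simp
qed

text \<open>A directional derivative is the same integral with \<open>\<rho>\<close> replaced by
  minus its directional derivative, so the induction varies \<open>\<rho>\<close> and keeps
  \<open>f\<close>.\<close>

lemma C_k_convolution:
  fixes f \<rho> :: "'a::euclidean_space \<Rightarrow> real"
  assumes f: "continuous_on UNIV f" and \<rho>: "\<And>j. C_k j \<rho>"
  shows "C_k k (\<lambda>x. integral (cbox a b) (\<lambda>y. f y * \<rho> (y - x)))"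
  using \<rho>
proof (induction k arbitrary: \<rho>)
  case 0
  then show ?case
    using convolution_has_derivative[OF f, of 0 \<rho> a b]
    by (auto intro!: continuous_at_imp_continuous_on has_derivative_continuous)
next
  case (Suc k)
  note D = convolution_has_derivative[OF f Suc.prems[of "Suc k"], of a b]
  have "C_k j (\<lambda>z. - frechet_derivative \<rho> (at z) v)" for j v
    using Suc.prems[of "Suc j"] by (auto intro: C_k_uminus)
  from Suc.IH[OF this] have "C_k k (\<lambda>x. frechet_derivative
      (\<lambda>x. integral (cbox a b) (\<lambda>y. f y * \<rho> (y - x))) (at x) v)" for v
    by (simp add: frechet_derivative_at[OF D, symmetric])
  then show ?case
    using differentiableI[OF D] by simp
qed

section \<open>Lipschitz constants on small balls\<close>

text \<open>The hypothesis provides an element of the set under \<open>Inf\<close>; the infimum of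
  the empty set is unspecified.\<close>

lemma Lip_nonneg:
  assumes "C-lipschitz_on E f"
  shows "0 \<le> Lip f E"
  unfolding Lip_def using assms by (intro cInf_greatest) (auto simp: lipschitz_on_nonneg)

lemma Lip_le:
  assumes "C-lipschitz_on E f"
  shows "Lip f E \<le> C"
  unfolding Lip_def using assms
  by (intro cInf_lower) (auto simp: bdd_below_def intro: lipschitz_on_nonneg)

text \<open>The infimum is attained: each difference quotient is a lower bound of the admissible
  constants.\<close>

lemma lipschitz_on_Lip:
  assumes "C-lipschitz_on E f"
  shows "(Lip f E)-lipschitz_on E f"
proof (rule lipschitz_onI)
  fix x y assume xy: "x \<in> E" "y \<in> E"
  show "dist (f x) (f y) \<le> Lip f E * dist x y"
  proof (cases "x = y")
    case False
    then have "dist (f x) (f y) / dist x y \<le> Lip f E"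
      unfolding Lip_def using assms xy
      by (intro cInf_greatest) (auto simp: pos_divide_le_eq dest: lipschitz_onD)
    then show ?thesis
      using False by (simp add: pos_divide_le_eq)
  qed simp
qed (rule Lip_nonneg[OF assms])

lemma Lip_mono:
  assumes "C-lipschitz_on F f" "E \<subseteq> F"
  shows "Lip f E \<le> Lip f F"
  using Lip_le lipschitz_on_subset[OF lipschitz_on_Lip[OF assms(1)] assms(2)] by blast

lemma Lip_const:
  assumes "\<And>y. y \<in> E \<Longrightarrow> f y = 0"
  shows "Lip f E = 0"
proof -
  have "0-lipschitz_on E f"
    using assms by (auto simp: lipschitz_on_def)
  then show ?thesis
    using Lip_le Lip_nonneg by fastforce
qed

text \<open>The superlevel sets are open: a violation of the constant \<open>c\<close> is witnessed
  by two points of an open ball, and they stay inside when its centre moves slightly.\<close>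

lemma borel_measurable_Lip_ball:
  assumes lip: "C-lipschitz_on UNIV f"
  shows "(\<lambda>x. Lip f (ball x r)) \<in> borel_measurable borel"
proof (rule borel_measurableI_greater)
  fix c
  have L: "C-lipschitz_on (ball x r) f" for x
    using lip lipschitz_on_subset by blast
  have "open {x. c < Lip f (ball x r)}"
  \<comment> \<open>\<open>lipschitz_on\<close> includes nonnegativity of the constant, so for
    negative \<open>c\<close> its failure says nothing about pairs of points.\<close>
  proof (cases "c < 0")
    case True
    then have "{x. c < Lip f (ball x r)} = UNIV"
      using Lip_nonneg[OF L] by (auto intro: less_le_trans)
    then show ?thesis by simp
  next
    case False
    let ?A = "{(y, z). c * dist y z < dist (f y) (f z)}"
    have "c < Lip f (ball x r) \<longleftrightarrow> (\<exists>(y, z)\<in>?A. y \<in> ball x r \<and> z \<in> ball x r)" for x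
    proof
      assume "c < Lip f (ball x r)"
      then have "\<not> c-lipschitz_on (ball x r) f"
        using Lip_le by fastforce
      then show "\<exists>(y, z)\<in>?A. y \<in> ball x r \<and> z \<in> ball x r"
        using False unfolding lipschitz_on_def by (force simp: not_le)
    next
      assume "\<exists>(y, z)\<in>?A. y \<in> ball x r \<and> z \<in> ball x r"
      then obtain y z where yz: "c * dist y z < dist (f y) (f z)" "y \<in> ball x r" "z \<in> ball x r"
        by auto
      then have "dist (f y) (f z) \<le> Lip f (ball x r) * dist y z"
        using lipschitz_onD[OF lipschitz_on_Lip[OF L]] by blast
      with yz(1) have "c * dist y z < Lip f (ball x r) * dist y z"
        by linarith
      then show "c < Lip f (ball x r)"
        by (simp add: mult_less_cancel_right)
    qed
    then have "{x. c < Lip f (ball x r)} = (\<Union>(y, z)\<in>?A. ball y r \<inter> ball z r)"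
      by (simp add: set_eq_iff dist_commute Bex_def case_prod_beta)
    then show ?thesis
      by (auto intro!: open_UN)
  qed
  then show "{x \<in> space borel. c < Lip f (ball x r)} \<in> sets borel"
    by simp
qed

text \<open>\<open>Lip f (ball x r)\<close> decreases as \<open>r\<close> shrinks, so the limit
  exists and is the infimum over positive \<open>r\<close>; without convergence \<open>Lim\<close>
  in \<open>lip_a\<close> would be unspecified.\<close>

lemma tendsto_lip_a:
  assumes lip: "C-lipschitz_on UNIV f"
  shows "((\<lambda>r. Lip f (ball x r)) \<longlongrightarrow> lip_a f x) (at_right 0)"
proof -
  let ?h = "\<lambda>r. Lip f (ball x r)"
  define l where "l = Inf (?h ` {0<..})"
  have L: "C-lipschitz_on (ball x r) f" for r
    using lip lipschitz_on_subset by blast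
  have bdd: "bdd_below (?h ` {0<..})"
    using Lip_nonneg[OF L] by (auto simp: bdd_below_def)
  have "(?h \<longlongrightarrow> l) (at_right 0)"
  proof (rule order_tendstoI)
    fix a assume "a < l"
    then have "a < ?h r" if "r > 0" for r
      using that cInf_lower[OF imageI bdd, of r] by (simp add: l_def)
    then show "\<forall>\<^sub>F r in at_right 0. a < ?h r"
      by (rule eventually_mono[OF eventually_at_right_less])
  next
    fix a assume "l < a"
    then obtain r0 where r0: "r0 > 0" "?h r0 < a"
      using cInf_less_iff[OF _ bdd, of a] by (auto simp: l_def)
    have "?h r < a" if "0 < r" "r < r0" for r
      using r0(2) Lip_mono[OF L, of "ball x r" r0] subset_ball[of r r0 x] that by linarith
    then show "\<forall>\<^sub>F r in at_right 0. ?h r < a"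
      using r0(1) unfolding eventually_at_right_field by blast
  qed
  then show ?thesis
    unfolding lip_a_def by (metis tendsto_Lim trivial_limit_at_right_real)
qed

text \<open>\<open>g\<close> averages the translates of \<open>f\<close> by vectors shorter than
  \<open>e / 2\<close>. Averaging does not increase Lipschitz constants, and only values of
  \<open>f\<close> near \<open>x\<close> enter. This yields the local constant on
  \<open>ball x e\<close> instead of the global \<open>C\<close>, and the local one tends to
  \<open>lip_a f x\<close>.\<close>

lemma mollification:
  fixes f :: "'a::euclidean_space \<Rightarrow> real"
  assumes f: "compactly_supported f" and lip: "C-lipschitz_on UNIV f" and e: "e > 0"
  obtains g where "g \<in> Cinf_c" "\<And>x. norm (grad g x) \<le> Lip f (ball x e)"
    "\<And>x. \<bar>g x - f x\<bar> \<le> C * e" "\<And>x. g x \<noteq> 0 \<Longrightarrow> \<exists>y. f y \<noteq> 0 \<and> dist x y < e"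
proof -
  \<comment> \<open>With kernel radius \<open>e / 2\<close>, points within \<open>e / 2\<close> of
    \<open>x\<close> and their translates stay inside \<open>ball x e\<close>.\<close>
  obtain \<rho> :: "'a \<Rightarrow> real" where \<rho>: "\<rho> \<in> Cinf_c" "\<And>x. 0 \<le> \<rho> x"
    "\<And>x. \<rho> x \<noteq> 0 \<Longrightarrow> norm x < e / 2" "integral\<^sup>L lborel \<rho> = 1"
    using bump_exists[of "e / 2"] e by auto
  have cf: "continuous_on UNIV f"
    using lip lipschitz_on_continuous_on by blast
  have c\<rho>: "continuous_on UNIV \<rho>"
    using \<rho>(1) Cinf_cD(1) C_k_continuous_on by blast
  obtain a b where ab: "{x. f x \<noteq> 0} \<subseteq> cbox a b"
    using f bounded_subset_cbox_symmetric unfolding compactly_supported_iff by metis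
  \<comment> \<open>The box form serves the smoothness proof; the fact \<open>g\<close> below
    rewrites it as an average of \<open>f (x + z)\<close> over the whole space, as the estimates
    need.\<close>
  define g where "g = (\<lambda>x. integral (cbox a b) (\<lambda>y. f y * \<rho> (y - x)))"
  have bd\<rho>: "bounded {z. h z * \<rho> z \<noteq> 0}" for h
    by (rule bounded_subset[of "ball 0 (e / 2)"]) (auto dest: \<rho>(3))
  have int: "integrable lborel (\<lambda>z. h z * \<rho> z)" if "continuous_on UNIV h" for h
    using that c\<rho> bd\<rho> by (intro radon_integrable_continuous[OF radon_lborel] continuous_intros)
  have g: "g x = (\<integral>z. f (x + z) * \<rho> z \<partial>lborel)" for x
  proof -
    have c: "continuous_on UNIV (\<lambda>y. f y * \<rho> (y - x))"
      by (intro continuous_intros cf continuous_on_compose2[OF c\<rho>]) auto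
    have "bounded {y. f y * \<rho> (y - x) \<noteq> 0}"
      by (rule bounded_subset[of "{x. f x \<noteq> 0}"]) (use f in \<open>auto simp: compactly_supported_iff\<close>)
    then have i: "integrable lborel (\<lambda>y. f y * \<rho> (y - x))"
      by (rule radon_integrable_continuous[OF radon_lborel c])
    have "g x = integral UNIV (\<lambda>y. if y \<in> cbox a b then f y * \<rho> (y - x) else 0)"
      by (simp add: g_def integral_restrict_UNIV)
    also have "(\<lambda>y. if y \<in> cbox a b then f y * \<rho> (y - x) else 0) = (\<lambda>y. f y * \<rho> (y - x))"
      using ab by fastforce
    also have "integral UNIV \<dots> = (\<integral>y. f y * \<rho> (y - x) \<partial>distr lborel borel ((+) x))"
      using integral_lborel[OF i] by (simp add: lborel_distr_plus)
    also have "\<dots> = (\<integral>z. f (x + z) * \<rho> z \<partial>lborel)"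
      using borel_measurable_continuous_onI[OF c] by (subst integral_distr) auto
    finally show ?thesis .
  qed
  have cs: "continuous_on UNIV (\<lambda>z. f (x + z))" for x
    by (intro continuous_on_compose2[OF cf] continuous_intros) auto
  \<comment> \<open>Compares \<open>g x\<close> with the \<open>\<rho>\<close>-average of another
    function \<open>h\<close>: a translate of \<open>f\<close> for the gradient bound, the constant
    \<open>f x\<close> for the uniform bound.\<close>
  have est: "\<bar>g x - c\<bar> \<le> L" if "\<And>z. norm z < e / 2 \<Longrightarrow> \<bar>f (x + z) - h z\<bar> \<le> L"
    "c = (\<integral>z. h z * \<rho> z \<partial>lborel)" "continuous_on UNIV h" for x c h L
  proof -
    have "\<bar>g x - c\<bar> = \<bar>\<integral>z. (f (x + z) - h z) * \<rho> z \<partial>lborel\<bar>"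
      using that int[OF cs[of x]] int[OF that(3)] by (simp add: g left_diff_distrib)
    also have "\<dots> \<le> (\<integral>z. \<bar>(f (x + z) - h z) * \<rho> z\<bar> \<partial>lborel)"
      by (rule integral_abs_bound)
    also have "\<dots> \<le> (\<integral>z. L * \<rho> z \<partial>lborel)"
    proof (rule integral_mono)
      show "integrable lborel (\<lambda>z. \<bar>(f (x + z) - h z) * \<rho> z\<bar>)"
        by (intro integrable_abs int continuous_intros cs that)
      show "integrable lborel (\<lambda>z. L * \<rho> z)"
        by (intro int continuous_intros)
      show "\<bar>(f (x + z) - h z) * \<rho> z\<bar> \<le> L * \<rho> z" for z
      proof (cases "\<rho> z = 0")
        case False
        then show ?thesis
          using that(1)[of z] \<rho>(2)[of z] \<rho>(3)[of z] by (simp add: abs_mult mult_right_mono)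
      qed simp
    qed
    also have "\<dots> = L"
      using \<rho>(4) by simp
    finally show ?thesis .
  qed
  have smooth: "C_k k g" for k
    unfolding g_def using C_k_convolution[OF cf Cinf_cD(1)[OF \<rho>(1)]] by blast
  have supp: "\<exists>y. f y \<noteq> 0 \<and> dist x y < e" if "g x \<noteq> 0" for x
  proof (rule ccontr)
    assume "\<nexists>y. f y \<noteq> 0 \<and> dist x y < e"
    then have "f (x + z) * \<rho> z = 0" for z
      using \<rho>(3)[of z] e by (force simp: dist_norm)
    then have "(\<lambda>z. f (x + z) * \<rho> z) = (\<lambda>_. 0)"
      by (rule ext)
    then show False
      using that by (simp only: g) simp
  qed
  have bd: "bounded {x. g x \<noteq> 0}"
  proof -
    obtain R where R: "\<And>y. f y \<noteq> 0 \<Longrightarrow> norm y \<le> R"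
      using f by (auto simp: compactly_supported_iff bounded_iff)
    have "norm x \<le> R + e" if gx: "g x \<noteq> 0" for x
    proof -
      obtain y where "f y \<noteq> 0" "dist x y < e"
        using supp[OF gx] by blast
      then show ?thesis
        using R[of y] norm_triangle_sub[of x y] by (simp add: dist_norm)
    qed
    then show ?thesis
      by (auto simp: bounded_iff)
  qed
  show thesis
  proof (rule that)
    show "g \<in> Cinf_c"
      using smooth bd by (simp add: Cinf_c_def compactly_supported_iff)
    show "norm (grad g x) \<le> Lip f (ball x e)" for x
    proof -
      have L: "C-lipschitz_on (ball x e) f"
        using lip lipschitz_on_subset by blast
      have "\<bar>g y - g x\<bar> \<le> Lip f (ball x e) * dist y x" if y: "dist y x < e / 2" for y
      proof (rule est[OF _ g cs])
        fix z :: 'a assume z: "norm z < e / 2"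
        have "dist x (y + z) \<le> dist y x + norm z"
          using norm_triangle_ineq[of "y - x" z] by (simp add: dist_norm norm_minus_commute algebra_simps)
        then have "y + z \<in> ball x e" "x + z \<in> ball x e"
          using y z e by (auto simp: dist_norm)
        then show "\<bar>f (y + z) - f (x + z)\<bar> \<le> Lip f (ball x e) * dist y x"
          using lipschitz_onD[OF lipschitz_on_Lip[OF L], of "y + z" "x + z"] by (simp add: dist_norm)
      qed
      then show ?thesis
        using norm_grad_le[OF smooth[of "Suc 0"], of "e / 2"] Lip_nonneg[OF L] e by simp
    qed
    show "\<bar>g x - f x\<bar> \<le> C * e" for x
    proof (rule est)
      show "f x = (\<integral>z. f x * \<rho> z \<partial>lborel)"
        using \<rho>(4) by simp
      fix z :: 'a assume z: "norm z < e / 2"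
      have "\<bar>f (x + z) - f x\<bar> \<le> C * norm z"
        using lipschitz_onD[OF lip, of "x + z" x] by (simp add: dist_norm)
      also have "\<dots> \<le> C * e"
        using z e lipschitz_on_nonneg[OF lip] by (intro mult_left_mono) auto
      finally show "\<bar>f (x + z) - f x\<bar> \<le> C * e" .
    qed simp
  qed (rule supp)
qed

lemma Cinf_c_bounded:
  assumes "f \<in> Cinf_c"
  shows "continuous_on UNIV f" "bounded {x. f x \<noteq> 0}"
    "continuous_on UNIV (grad f)" "bounded {x. grad f x \<noteq> 0}"
proof -
  show "continuous_on UNIV f" "continuous_on UNIV (grad f)"
    using Cinf_cD(1)[OF assms] C_k_continuous_on continuous_on_grad by blast+
  show b: "bounded {x. f x \<noteq> 0}"
    using Cinf_cD(2)[OF assms] by (simp add: compactly_supported_iff)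
  have "{x. grad f x \<noteq> 0} \<subseteq> closure {x. f x \<noteq> 0}"
    using grad_eq_0[OF Cinf_cD(1)[OF assms]] by blast
  then show "bounded {x. grad f x \<noteq> 0}"
    using bounded_closure[OF b] bounded_subset by blast
qed

lemma Cinf_c_integrable:
  assumes "radon_measure \<mu>" "f \<in> Cinf_c"
  shows "integrable \<mu> f" "integrable \<mu> (grad f)"
  using radon_integrable_continuous[OF assms(1)] Cinf_c_bounded[OF assms(2)] by blast+

text \<open>\<open>h\<close> is the Lipschitz constant of \<open>F\<close> on balls of one small
  radius. It tends to \<open>lip_a F\<close> pointwise, below a multiple of the indicator of a
  compact set, so dominated convergence applies.\<close>

lemma smooth_approx_lip_a:
  assumes \<mu>: "radon_measure \<mu>" and F: "F \<in> LIP_c" and d: "\<delta> > 0"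
  obtains g h where "g \<in> Cinf_c" "integrable \<mu> h" "\<And>x. norm (grad g x) \<le> h x"
    "(\<integral>x. \<bar>g x - F x\<bar> \<partial>\<mu>) \<le> \<delta>" "(\<integral>x. \<bar>h x - lip_a F x\<bar> \<partial>\<mu>) \<le> \<delta>"
proof -
  obtain C where lip: "C-lipschitz_on UNIV F" and cs: "compactly_supported F"
    using F by (auto simp: LIP_c_def)
  have C: "0 \<le> C" using lip lipschitz_on_nonneg by blast
  obtain R where R: "\<And>y. F y \<noteq> 0 \<Longrightarrow> norm y \<le> R"
    using cs by (auto simp: compactly_supported_iff bounded_iff)
  \<comment> \<open>All radii \<open>e n\<close> are at most 1, so \<open>F\<close> vanishes on each
    \<open>ball x (e n)\<close> with \<open>x\<close> outside \<open>K\<close>.\<close>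
  define K where "K = cball (0::'a) (R + 1)"
  define e where "e = (\<lambda>n. 1 / real (Suc n))"
  have e: "0 < e n" "e n \<le> 1" "e n \<noteq> 0" for n by (auto simp: e_def field_simps)
  have e0: "e \<longlonglongrightarrow> 0"
    unfolding e_def using LIMSEQ_inverse_real_of_nat by (simp add: inverse_eq_divide)
  have far: "F y = 0" if "x \<notin> K" "dist x y < e n" for x y n
    using that R[of y] e(2)[of n] norm_triangle_sub[of x y] by (force simp: K_def dist_norm)
  define h where "h = (\<lambda>n x. Lip F (ball x (e n)))"
  have L: "C-lipschitz_on (ball x r) F" for x r
    using lip lipschitz_on_subset by blast
  have h: "0 \<le> h n x" "h n x \<le> C * indicator K x" for n x
  proof -
    show "0 \<le> h n x" unfolding h_def by (rule Lip_nonneg[OF L])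
    show "h n x \<le> C * indicator K x"
      using Lip_le[OF L] Lip_const[of "ball x (e n)" F] far[of x _ n]
      by (cases "x \<in> K") (auto simp: h_def)
  qed
  have hlim: "(\<lambda>n. h n x) \<longlonglongrightarrow> lip_a F x" for x
    unfolding h_def
    by (rule filterlim_compose[OF tendsto_lip_a[OF lip]])
      (use e e0 in \<open>auto simp: filterlim_at\<close>)
  have l: "0 \<le> lip_a F x" "lip_a F x \<le> C * indicator K x" for x
    using hlim[of x] h by (auto intro: LIMSEQ_le_const LIMSEQ_le_const2)
  have hm: "h n \<in> borel_measurable borel" for n
    unfolding h_def by (rule borel_measurable_Lip_ball[OF lip])
  have lm: "lip_a F \<in> borel_measurable borel"
    by (rule borel_measurable_LIMSEQ_real[OF hlim hm])
  have K: "compact K" by (simp add: K_def)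
  have hi: "integrable \<mu> (h n)" for n
    by (rule radon_integrableI[OF \<mu> hm K, of _ C]) (use h in auto)
  have Ki: "integrable \<mu> (\<lambda>x. c * indicator K x :: real)" for c
    by (rule radon_integrableI[OF \<mu> _ K, of _ "\<bar>c\<bar>"]) (use K in \<open>auto intro!: borel_measurable_times borel_measurable_indicator borel_compact simp: abs_mult\<close>)
  have sb: "sets \<mu> = sets borel" using \<mu> by (simp add: radon_measure_def)
  have "(\<lambda>n. \<integral>x. \<bar>h n x - lip_a F x\<bar> \<partial>\<mu>) \<longlonglongrightarrow> (\<integral>x. 0 \<partial>\<mu>)"
  proof (rule integral_dominated_convergence[where w = "\<lambda>x. C * indicator K x"])
    show "(\<lambda>x. \<bar>h n x - lip_a F x\<bar>) \<in> borel_measurable \<mu>" for n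
      unfolding measurable_cong_sets[OF sb refl] using hm lm by measurable
    show "AE x in \<mu>. (\<lambda>n. \<bar>h n x - lip_a F x\<bar>) \<longlonglongrightarrow> 0"
      using hlim by (intro AE_I2 tendsto_rabs_zero) (simp add: LIM_zero)
    show "AE x in \<mu>. norm \<bar>h n x - lip_a F x\<bar> \<le> C * indicator K x" for n
    proof (rule AE_I2)
      fix x show "norm \<bar>h n x - lip_a F x\<bar> \<le> C * indicator K x"
        using h[of n x] l[of x] by simp
    qed
  qed (use Ki[of 1] in auto)
  then have "\<forall>\<^sub>F n in sequentially. (\<integral>x. \<bar>h n x - lip_a F x\<bar> \<partial>\<mu>) < \<delta>"
    using d by (auto dest: order_tendstoD)
  \<comment> \<open>The mollification moves \<open>F\<close> by at most \<open>C * e n\<close>, and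
    only inside \<open>K\<close>; \<open>e n * I\<close> is the resulting \<open>L\<^sup>1\<close>
    bound.\<close>
  moreover define I where "I = (\<integral>x. C * indicator K x \<partial>\<mu>)"
  have "(\<lambda>n. e n * I) \<longlonglongrightarrow> 0"
    using tendsto_mult_left_zero[OF e0] .
  then have "\<forall>\<^sub>F n in sequentially. e n * I < \<delta>"
    using d by (auto dest: order_tendstoD)
  ultimately have "\<forall>\<^sub>F n in sequentially. (\<integral>x. \<bar>h n x - lip_a F x\<bar> \<partial>\<mu>) < \<delta> \<and> e n * I < \<delta>"
    by (rule eventually_conj)
  then obtain n where n: "(\<integral>x. \<bar>h n x - lip_a F x\<bar> \<partial>\<mu>) < \<delta>" "e n * I < \<delta>"
    using eventually_happens'[OF sequentially_bot] by blast
  obtain g where g: "g \<in> Cinf_c" "\<And>x. norm (grad g x) \<le> Lip F (ball x (e n))"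
    "\<And>x. \<bar>g x - F x\<bar> \<le> C * e n" "\<And>x. g x \<noteq> 0 \<Longrightarrow> \<exists>y. F y \<noteq> 0 \<and> dist x y < e n"
    using mollification[OF cs lip e(1)] by blast
  have "\<bar>g x - F x\<bar> \<le> e n * (C * indicator K x)" for x
    using g(3,4)[of x] far[of x _ n] e(1)[of n] by (cases "x \<in> K") (auto simp: mult.commute)
  moreover have "integrable \<mu> F"
    using radon_integrable_continuous[OF \<mu> lipschitz_on_continuous_on[OF lip]] cs
    by (simp add: compactly_supported_iff)
  ultimately have "(\<integral>x. \<bar>g x - F x\<bar> \<partial>\<mu>) \<le> (\<integral>x. e n * (C * indicator K x) \<partial>\<mu>)"
    using Cinf_c_integrable(1)[OF \<mu> g(1)]
    by (intro integral_mono integrable_abs Bochner_Integration.integrable_diff integrable_mult_right Ki)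
  also have "\<dots> = e n * I"
    unfolding I_def by (rule integral_mult_right_zero)
  finally show thesis
    using that[OF g(1) hi[of n]] g(2) n by (simp add: h_def)
qed

text \<open>Smooth functions approximate indicators of boxes boundedly, so \<open>u\<close> has
  integral 0 over each box. Boxes generate the Borel sets and are stable under intersection, hence
  the positive and negative parts of \<open>u\<close> are densities of the same finite
  measure.\<close>

lemma fundamental_lemma:
  fixes u :: "'a::euclidean_space \<Rightarrow> real"
  assumes \<mu>: "radon_measure \<mu>" and u: "integrable \<mu> u"
    and 0: "\<And>\<phi>. \<phi> \<in> Cinf_c \<Longrightarrow> (\<integral>x. \<phi> x * u x \<partial>\<mu>) = 0"
  shows "AE x in \<mu>. u x = 0"
proof -
  have sb[measurable_cong]: "sets \<mu> = sets borel" using \<mu> by (simp add: radon_measure_def)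
  note [measurable] = borel_measurable_integrable[OF u]
  have box: "(\<integral>x. indicator (box a b) x * u x \<partial>\<mu>) = 0" for a b :: 'a
  proof -
    let ?A = "- box a b"
    \<comment> \<open>\<open>infdist\<close> to the empty set is 0 by default, so the complement of
      the box has to be nonempty.\<close>
    have ne: "?A \<noteq> {}"
      using bounded_box[of a b] not_bounded_UNIV by (metis Compl_empty_eq double_compl)
    \<comment> \<open>Lipschitz functions with constant \<open>Suc n\<close> that increase to the
      indicator of the open box.\<close>
    define f where "f = (\<lambda>n x. min 1 (real (Suc n) * infdist x ?A))"
    have min1: "\<bar>min 1 s - min 1 t\<bar> \<le> \<bar>s - t\<bar>" for s t :: real
      by linarith
    have lip: "(real (Suc n))-lipschitz_on UNIV (f n)" for n
    proof (rule lipschitz_onI)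
      fix x y
      have "\<bar>infdist x ?A - infdist y ?A\<bar> \<le> dist x y"
        by (rule infdist_triangle_abs)
      then have "\<bar>real (Suc n) * infdist x ?A - real (Suc n) * infdist y ?A\<bar> \<le> real (Suc n) * dist x y"
        by (simp add: abs_mult right_diff_distrib[symmetric] mult_left_mono del: of_nat_Suc)
      then show "dist (f n x) (f n y) \<le> real (Suc n) * dist x y"
        using order_trans[OF min1] by (simp add: f_def dist_real_def del: of_nat_Suc)
    qed simp
    have f0: "f n x = 0" if "x \<notin> box a b" for n x
      using that by (simp add: f_def)
    have "bounded {x. f n x \<noteq> 0}" for n
      by (rule bounded_subset[OF bounded_box[of a b]]) (use f0 in blast)
    then have cs: "compactly_supported (f n)" for n
      by (simp add: compactly_supported_iff)
    have "\<exists>g. g \<in> Cinf_c \<and> (\<forall>x. \<bar>g x - f n x\<bar> \<le> 1 / real (Suc n))" for n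
    proof -
      \<comment> \<open>Mollification costs the Lipschitz constant times the radius; the square
        turns this into \<open>1 / real (Suc n)\<close>.\<close>
      define e where "e = 1 / (real (Suc n))\<^sup>2"
      have e: "e > 0" "real (Suc n) * e = 1 / real (Suc n)"
        by (simp_all add: e_def power2_eq_square)
      from mollification[OF cs[of n] lip[of n] e(1)] show ?thesis
        unfolding e(2) by metis
    qed
    then obtain g where g: "\<And>n. g n \<in> Cinf_c" "\<And>n x. \<bar>g n x - f n x\<bar> \<le> 1 / real (Suc n)"
      by metis
    have flim: "(\<lambda>n. f n x) \<longlonglongrightarrow> indicator (box a b) x" for x
    proof (cases "x \<in> box a b")
      case False
      then show ?thesis by (simp add: f0)
    next
      case True
      then have "infdist x ?A > 0"
        using infdist_pos_not_in_closed[of ?A x] ne by (simp add: open_box closed_Compl)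
      then obtain N where N: "1 < real N * infdist x ?A"
        using reals_Archimedean3 by blast
      have "f n x = 1" if "n \<ge> N" for n
      proof -
        have "real N * infdist x ?A \<le> real (Suc n) * infdist x ?A"
          using that by (intro mult_right_mono) (auto simp: infdist_nonneg)
        then show ?thesis using N by (simp add: f_def)
      qed
      then have "\<forall>\<^sub>F n in sequentially. f n x = 1"
        using eventually_sequentially by blast
      then show ?thesis
        using True tendsto_eventually by fastforce
    qed
    have glim: "(\<lambda>n. g n x) \<longlonglongrightarrow> indicator (box a b) x" for x
    proof -
      have "(\<lambda>n. g n x - f n x) \<longlonglongrightarrow> 0"
        by (rule Lim_null_comparison[OF _ LIMSEQ_Suc[OF lim_1_over_n]]) (use g(2) in auto)
      from tendsto_add[OF this flim[of x]] show ?thesis by simp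
    qed
    have g2: "\<bar>g n x\<bar> \<le> 2" for n x
    proof -
      have "0 \<le> f n x" "f n x \<le> 1" "1 / real (Suc n) \<le> 1"
        by (auto simp: f_def infdist_nonneg)
      then show ?thesis using g(2)[of n x] by linarith
    qed
    have gm[measurable]: "g n \<in> borel_measurable borel" for n
      using Cinf_c_bounded(1)[OF g(1)] by (rule borel_measurable_continuous_onI)
    have "(\<lambda>n. \<integral>x. g n x * u x \<partial>\<mu>) \<longlonglongrightarrow> (\<integral>x. indicator (box a b) x * u x \<partial>\<mu>)"
    proof (rule integral_dominated_convergence[where w = "\<lambda>x. 2 * \<bar>u x\<bar>"])
      show "AE x in \<mu>. (\<lambda>n. g n x * u x) \<longlonglongrightarrow> indicator (box a b) x * u x"
        by (intro AE_I2 tendsto_mult glim tendsto_const)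
      show "AE x in \<mu>. norm (g n x * u x) \<le> 2 * \<bar>u x\<bar>" for n
        using g2 by (intro AE_I2) (simp add: abs_mult mult_right_mono)
    qed (use u in auto)
    then show ?thesis
      by (simp add: 0[OF g(1)] LIMSEQ_const_iff)
  qed
  define p where "p = (\<lambda>x. max 0 (u x))"
  define q where "q = (\<lambda>x. max 0 (- u x))"
  have int: "integrable \<mu> p" "integrable \<mu> q"
    unfolding p_def q_def using u by auto
  note [measurable] = int[THEN borel_measurable_integrable]
  have nn: "0 \<le> p x" "0 \<le> q x" for x by (auto simp: p_def q_def)
  have fin: "(\<integral>\<^sup>+x. ennreal (v x) \<partial>\<mu>) \<noteq> \<infinity>" if "integrable \<mu> v" "\<And>x. 0 \<le> v x" for v
    using that by (simp add: nn_integral_eq_integral)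
  have dens: "emeasure (density \<mu> v) (box a b) = ennreal (\<integral>x. indicator (box a b) x * v x \<partial>\<mu>)"
    if "integrable \<mu> v" "\<And>x. 0 \<le> v x" for v :: "'a \<Rightarrow> real" and a b :: 'a
  proof -
    have [measurable]: "v \<in> borel_measurable \<mu>" using that by auto
    have "emeasure (density \<mu> v) (box a b) = (\<integral>\<^sup>+x. ennreal (indicator (box a b) x * v x) \<partial>\<mu>)"
      by (subst emeasure_density)
        (auto simp: sb intro!: nn_integral_cong split: split_indicator)
    also have "\<dots> = ennreal (\<integral>x. indicator (box a b) x * v x \<partial>\<mu>)"
      using that integrable_mult_indicator[of "box a b" \<mu> v]
      by (intro nn_integral_eq_integral) (auto simp: sb)
    finally show ?thesis .
  qed
  have "density \<mu> p = density \<mu> q"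
  proof (rule measure_eqI_generator_eq[where E = "range (\<lambda>(a, b). box a b)" and \<Omega> = UNIV
        and A = "\<lambda>i::nat. box (- (real i *\<^sub>R One)) (real i *\<^sub>R One)"])
    show "Int_stable (range (\<lambda>(a, b). box a b :: 'a set))"
      by (auto simp: Int_stable_def box_Int_box)
    show "emeasure (density \<mu> p) X = emeasure (density \<mu> q) X"
      if X: "X \<in> range (\<lambda>(a, b). box a b)" for X
    proof -
      obtain a b where X: "X = box a b" using X by auto
      have i: "integrable \<mu> (\<lambda>x. indicator (box a b) x * v x)" if "integrable \<mu> v" for v :: "'a \<Rightarrow> real"
        using integrable_mult_indicator[of "box a b" \<mu> v] that by (simp add: sb)
      have "(\<integral>x. indicator (box a b) x * p x \<partial>\<mu>) - (\<integral>x. indicator (box a b) x * q x \<partial>\<mu>) =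
          (\<integral>x. indicator (box a b) x * u x \<partial>\<mu>)"
        by (subst Bochner_Integration.integral_diff[symmetric, OF i[OF int(1)] i[OF int(2)]])
          (auto simp: p_def q_def max_def intro!: Bochner_Integration.integral_cong split: split_indicator)
      then show ?thesis
        using box[of a b] dens[OF int(1) nn(1)] dens[OF int(2) nn(2)] by (simp add: X)
    qed
    show "sets (density \<mu> p) = sigma_sets UNIV (range (\<lambda>(a, b). box a b))"
      "sets (density \<mu> q) = sigma_sets UNIV (range (\<lambda>(a, b). box a b))"
      by (simp_all add: sb borel_eq_box)
    show "(\<Union>i. box (- (real i *\<^sub>R One)) (real i *\<^sub>R One) :: 'a set) = UNIV"
      unfolding UN_box_eq_UNIV ..
    show "emeasure (density \<mu> p) (box (- (real i *\<^sub>R One)) (real i *\<^sub>R One)) \<noteq> \<infinity>" for i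
      using dens[OF int(1) nn(1)] by simp
  qed auto
  then have "AE x in \<mu>. ennreal (p x) = ennreal (q x)"
    using finite_density_unique[of p \<mu> q] fin[OF int(1) nn(1)] by simp
  \<comment> \<open>\<open>p\<close> and \<open>q\<close> are never both positive, so where they
    agree \<open>u\<close> is 0.\<close>
  then show ?thesis
    by eventually_elim (auto simp: p_def q_def max_def split: if_splits)
qed

section \<open>Weak and strong closure of convex sets\<close>

text \<open>The vector space is a set \<open>V\<close> of functions because it will consist of the
  integrable ones. If \<open>V\<close> is closed under scaling, the inequality for
  \<open>c > 0\<close> implies equality, by scaling back with \<open>1 / c\<close>.\<close>

definition sublinear_on :: "('a \<Rightarrow> real) set \<Rightarrow> (('a \<Rightarrow> real) \<Rightarrow> real) \<Rightarrow> bool" where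
  "sublinear_on V p \<longleftrightarrow> (\<forall>f\<in>V. \<forall>g\<in>V. p (\<lambda>x. f x + g x) \<le> p f + p g) \<and>
     (\<forall>f\<in>V. \<forall>c>0. p (\<lambda>x. c * f x) \<le> c * p f)"

lemma sublinear_onD:
  assumes "sublinear_on V p" "f \<in> V"
  shows "g \<in> V \<Longrightarrow> p (\<lambda>x. f x + g x) \<le> p f + p g"
    and "c > 0 \<Longrightarrow> p (\<lambda>x. c * f x) \<le> c * p f"
  using assms by (auto simp: sublinear_on_def)

text \<open>Covers the three infima used below: along a chain of functionals, over shifts in one
  direction, and over multiples of differences between a convex set and a point.\<close>

lemma sublinear_on_Inf:
  assumes ne: "\<And>f. f \<in> V \<Longrightarrow> A f \<noteq> {}" and bdd: "\<And>f. f \<in> V \<Longrightarrow> bdd_below (A f)"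
    and V: "\<And>f g. f \<in> V \<Longrightarrow> g \<in> V \<Longrightarrow> (\<lambda>x. f x + g x) \<in> V" "\<And>f c. f \<in> V \<Longrightarrow> (\<lambda>x. c * f x) \<in> V"
    and add: "\<And>f g a b. f \<in> V \<Longrightarrow> g \<in> V \<Longrightarrow> a \<in> A f \<Longrightarrow> b \<in> A g \<Longrightarrow>
      \<exists>c\<in>A (\<lambda>x. f x + g x). c \<le> a + b"
    and scale: "\<And>f a c. f \<in> V \<Longrightarrow> c > 0 \<Longrightarrow> a \<in> A f \<Longrightarrow> \<exists>b\<in>A (\<lambda>x. c * f x). b \<le> c * a"
  shows "sublinear_on V (\<lambda>f. Inf (A f) :: real)"
  unfolding sublinear_on_def
proof (intro conjI ballI allI impI)
  fix f g assume f: "f \<in> V" and g: "g \<in> V"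
  let ?S = "Inf (A (\<lambda>x. f x + g x))"
  have "?S \<le> a + b" if "a \<in> A f" "b \<in> A g" for a b
    using add[OF f g that] cInf_lower[OF _ bdd[OF V(1)[OF f g]]] order_trans by blast
  then have "?S - a \<le> b" if "a \<in> A f" "b \<in> A g" for a b
    using that by (simp add: diff_le_eq add.commute)
  then have "?S - a \<le> Inf (A g)" if "a \<in> A f" for a
    using that ne[OF g] by (intro cInf_greatest) auto
  then have "?S - Inf (A g) \<le> a" if "a \<in> A f" for a
    using that by fastforce
  then have "?S - Inf (A g) \<le> Inf (A f)"
    using ne[OF f] by (intro cInf_greatest) auto
  then show "?S \<le> Inf (A f) + Inf (A g)"
    by simp
next
  fix f and c :: real assume f: "f \<in> V" and c: "0 < c"
  let ?S = "Inf (A (\<lambda>x. c * f x))"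
  have "?S / c \<le> a" if "a \<in> A f" for a
  proof -
    have "?S \<le> c * a"
      using scale[OF f c that] cInf_lower[OF _ bdd[OF V(2)[OF f]]] order_trans by blast
    then show ?thesis using c by (simp add: pos_divide_le_eq mult.commute)
  qed
  then have "?S / c \<le> Inf (A f)"
    using ne[OF f] by (intro cInf_greatest) auto
  then show "?S \<le> c * Inf (A f)"
    using c by (simp add: pos_divide_le_eq mult.commute)
qed

text \<open>Scaling by 2 shows that the value is at least 0, scaling by 1/2 that it is at most
  0.\<close>

lemma sublinear_on_zero:
  assumes p: "sublinear_on V p" and 0: "(\<lambda>x. 0) \<in> V"
  shows "p (\<lambda>x. 0) = 0"
  using sublinear_onD(2)[OF p 0, of 2] sublinear_onD(2)[OF p 0, of "1/2"] by simp

lemma sublinear_on_minus: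
  assumes p: "sublinear_on V p" and V: "\<And>f c. f \<in> V \<Longrightarrow> (\<lambda>x. c * f x) \<in> V" and f: "f \<in> V"
  shows "- p (\<lambda>x. - f x) \<le> p f"
proof -
  have "(\<lambda>x. 0) \<in> V" "(\<lambda>x. - f x) \<in> V"
    using V[OF f, of 0] V[OF f, of "-1"] by auto
  then show ?thesis
    using sublinear_onD(1)[OF p f, of "\<lambda>x. - f x"] sublinear_on_zero[OF p] by simp
qed

text \<open>The Hahn--Banach theorem: a sublinear functional that is minimal for the pointwise order is linear.\<close>

lemma minimal_sublinear_exists:
  assumes p: "sublinear_on V p"
    and V: "\<And>f g. f \<in> V \<Longrightarrow> g \<in> V \<Longrightarrow> (\<lambda>x. f x + g x) \<in> V" "\<And>f c. f \<in> V \<Longrightarrow> (\<lambda>x. c * f x) \<in> V"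
  obtains q where "sublinear_on V q" "\<And>f. f \<in> V \<Longrightarrow> q f \<le> p f"
    "\<And>r f. sublinear_on V r \<Longrightarrow> (\<And>f. f \<in> V \<Longrightarrow> r f \<le> q f) \<Longrightarrow> f \<in> V \<Longrightarrow> r f = q f"
proof -
  define A where "A = {q. sublinear_on V q \<and> (\<forall>f\<in>V. q f \<le> p f) \<and> (\<forall>f. f \<notin> V \<longrightarrow> q f = 0)}"
  \<comment> \<open>The reversed order, so that Zorn's lemma yields a pointwise minimal functional
    and infima bound the chains.\<close>
  define P where "P = (\<lambda>q r :: ('a \<Rightarrow> real) \<Rightarrow> real. \<forall>f. r f \<le> q f)"
  \<comment> \<open>Values off \<open>V\<close> are fixed to 0, so that the order, which compares
    all arguments, only sees what happens on \<open>V\<close>.\<close>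
  define cut where "cut = (\<lambda>(q :: ('a \<Rightarrow> real) \<Rightarrow> real) f. if f \<in> V then q f else 0)"
  have cut: "sublinear_on V (cut q)" if "sublinear_on V q" for q
    using that V unfolding sublinear_on_def cut_def by simp
  have "\<exists>m\<in>A. \<forall>a\<in>A. P m a \<longrightarrow> a = m"
  proof (rule predicate_Zorn)
    show "partial_order_on A (relation_of P A)"
      by (rule partial_order_on_relation_ofI) (auto simp: P_def fun_eq_iff intro: order_trans order_antisym)
    fix C assume C: "C \<in> Chains (relation_of P A)"
    then have CA: "C \<subseteq> A" and Cc: "\<And>q r. q \<in> C \<Longrightarrow> r \<in> C \<Longrightarrow> P q r \<or> P r q"
      by (auto simp: Chains_def relation_of_def)
    show "\<exists>u\<in>A. \<forall>a\<in>C. P a u"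
    proof (cases "C = {}")
      case True
      have "cut p \<in> A"
        using cut[OF p] by (auto simp: A_def cut_def)
      then show ?thesis using True by blast
    next
      case False
      have Csub: "sublinear_on V q" if "q \<in> C" for q
        using that CA by (auto simp: A_def)
      define u where "u = (\<lambda>f. Inf ((\<lambda>q. q f) ` C))"
      \<comment> \<open>The sum of \<open>q f\<close> and \<open>q (\<lambda>x. - f x)\<close> is
        nonnegative, so every \<open>q\<close> of the chain lies above a bound that depends on
        \<open>p\<close> alone.\<close>
      have bdd: "bdd_below ((\<lambda>q. q f) ` C)" if f: "f \<in> V" for f
      proof (rule bdd_belowI2)
        fix q assume "q \<in> C"
        then have q: "sublinear_on V q" "\<And>f. f \<in> V \<Longrightarrow> q f \<le> p f"
          using CA by (auto simp: A_def)
        have "(\<lambda>x. - f x) \<in> V" using V(2)[OF f, of "-1"] by simp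
        then show "- p (\<lambda>x. - f x) \<le> q f"
          using sublinear_on_minus[OF q(1) V(2) f] q(2) by fastforce
      qed
      have u: "sublinear_on V u"
        unfolding u_def
      proof (rule sublinear_on_Inf[OF _ bdd V])
        fix f g a b assume fg: "f \<in> V" "g \<in> V" and "a \<in> (\<lambda>q. q f) ` C" "b \<in> (\<lambda>q. q g) ` C"
        then obtain q r where qr: "q \<in> C" "r \<in> C" "a = q f" "b = r g" by blast
        from Cc[OF qr(1,2)] obtain m where m: "m \<in> C" "m f \<le> a" "m g \<le> b"
          using qr by (auto simp: P_def)
        then have "m (\<lambda>x. f x + g x) \<le> m f + m g"
          using fg by (intro sublinear_onD(1)[OF Csub])
        then show "\<exists>c\<in>(\<lambda>q. q (\<lambda>x. f x + g x)) ` C. c \<le> a + b"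
          using m(2,3) by (intro bexI[OF _ imageI[OF m(1)]]) linarith
      next
        fix f a and c :: real assume f: "f \<in> V" "0 < c" and "a \<in> (\<lambda>q. q f) ` C"
        then obtain q where q: "q \<in> C" "a = q f" by blast
        then have "q (\<lambda>x. c * f x) \<le> c * a"
          using sublinear_onD(2)[OF Csub f] by simp
        then show "\<exists>b\<in>(\<lambda>q. q (\<lambda>x. c * f x)) ` C. b \<le> c * a"
          using q by blast
      qed (use False in auto)
      have le: "u f \<le> q f" if "q \<in> C" "f \<in> V" for q f
        unfolding u_def using that bdd by (intro cInf_lower) auto
      obtain q0 where q0: "q0 \<in> C" using False by blast
      have "u f \<le> p f" if "f \<in> V" for f
      proof -
        have "q0 f \<le> p f" using CA q0 that by (auto simp: A_def)
        with le[OF q0 that] show ?thesis by linarith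
      qed
      then have "cut u \<in> A"
        using cut[OF u] by (auto simp: A_def cut_def)
      moreover have "P q (cut u)" if "q \<in> C" for q
        using that le CA by (auto simp: P_def cut_def A_def)
      ultimately show ?thesis by blast
    qed
  qed
  then obtain m where m: "m \<in> A" "\<And>a. a \<in> A \<Longrightarrow> P m a \<Longrightarrow> a = m"
    by blast
  show thesis
  proof (rule that[of m])
    show "sublinear_on V m" and mp: "\<And>f. f \<in> V \<Longrightarrow> m f \<le> p f"
      using m(1) by (auto simp: A_def)
    fix r f assume r: "sublinear_on V r" "\<And>f. f \<in> V \<Longrightarrow> r f \<le> m f" and f: "f \<in> V"
    have "cut r \<in> A"
      using cut[OF r(1)] order_trans[OF r(2) mp] by (auto simp: A_def cut_def)
    moreover have "P m (cut r)"
      using r(2) m(1) by (auto simp: P_def cut_def A_def)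
    ultimately have "cut r = m" by (rule m(2))
    then show "r f = m f" using f by (auto simp: cut_def)
  qed
qed

text \<open>Minimality supplies superadditivity; additivity then extends positive homogeneity to
  negative scalars.\<close>

lemma linear_below_sublinear:
  assumes p: "sublinear_on V p"
    and V: "\<And>f g. f \<in> V \<Longrightarrow> g \<in> V \<Longrightarrow> (\<lambda>x. f x + g x) \<in> V" "\<And>f c. f \<in> V \<Longrightarrow> (\<lambda>x. c * f x) \<in> V"
  obtains \<phi> where "\<And>f. f \<in> V \<Longrightarrow> \<phi> f \<le> p f"
    "\<And>f g. f \<in> V \<Longrightarrow> g \<in> V \<Longrightarrow> \<phi> (\<lambda>x. f x + g x) = \<phi> f + \<phi> g"
    "\<And>f c. f \<in> V \<Longrightarrow> \<phi> (\<lambda>x. c * f x) = c * \<phi> f"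
proof -
  obtain q where q: "sublinear_on V q" "\<And>f. f \<in> V \<Longrightarrow> q f \<le> p f"
    and min: "\<And>r f. sublinear_on V r \<Longrightarrow> (\<And>f. f \<in> V \<Longrightarrow> r f \<le> q f) \<Longrightarrow> f \<in> V \<Longrightarrow> r f = q f"
    using minimal_sublinear_exists[OF p V] by blast
  have neg: "(\<lambda>x. - f x) \<in> V" if "f \<in> V" for f using V(2)[OF that, of "-1"] by simp
  have q0: "q (\<lambda>x. 0) = 0" if "f \<in> V" for f
    using sublinear_on_zero[OF q(1)] V(2)[OF that, of 0] by simp
  have qle: "q (\<lambda>x. c * f x) \<le> c * q f" if "c \<ge> 0" "f \<in> V" for c f
    using that sublinear_onD(2)[OF q(1)] q0 by (cases "c = 0") auto
  have qeq: "q (\<lambda>x. c * f x) = c * q f" if c: "c \<ge> 0" and f: "f \<in> V" for c f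
  proof (cases "c = 0")
    case False
    then have "q (\<lambda>x. (1 / c) * (c * f x)) \<le> (1 / c) * q (\<lambda>x. c * f x)"
      using c V(2)[OF f] by (intro sublinear_onD(2)[OF q(1)]) auto
    then have "c * q f \<le> q (\<lambda>x. c * f x)"
      using False c by (simp add: field_simps)
    then show ?thesis using qle[OF c f] by simp
  qed (use q0 f in auto)
  have super: "q f + q g \<le> q (\<lambda>x. f x + g x)" if f: "f \<in> V" and g: "g \<in> V" for f g
  proof -
    \<comment> \<open>\<open>f \<mapsto> inf\<^sub>t q (f + t g) - t q g\<close> is sublinear and below \<open>q\<close>, so it equals \<open>q\<close>;
      take \<open>t = 1\<close>.\<close>
    define A where "A = (\<lambda>f. (\<lambda>t. q (\<lambda>x. f x + t * g x) - t * q g) ` {0..})"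
    define r where "r = (\<lambda>f. Inf (A f))"
    have bdd: "bdd_below (A f)" if f: "f \<in> V" for f
      unfolding A_def
    proof (rule bdd_belowI2)
      fix t :: real assume "t \<in> {0..}"
      then have "t * q g = q (\<lambda>x. t * g x)" using qeq g by simp
      also have "\<dots> = q (\<lambda>x. (f x + t * g x) + - f x)" by simp
      also have "\<dots> \<le> q (\<lambda>x. f x + t * g x) + q (\<lambda>x. - f x)"
        using V f g neg by (intro sublinear_onD(1)[OF q(1)]) auto
      finally show "- q (\<lambda>x. - f x) \<le> q (\<lambda>x. f x + t * g x) - t * q g" by simp
    qed
    have "sublinear_on V r"
      unfolding r_def
    proof (rule sublinear_on_Inf[OF _ bdd V])
      fix f h a b assume fh: "f \<in> V" "h \<in> V" and "a \<in> A f" "b \<in> A h"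
      then obtain s t where st: "s \<ge> 0" "t \<ge> 0" "a = q (\<lambda>x. f x + s * g x) - s * q g"
        "b = q (\<lambda>x. h x + t * g x) - t * q g" by (auto simp: A_def)
      have "q (\<lambda>x. (f x + s * g x) + (h x + t * g x)) \<le> q (\<lambda>x. f x + s * g x) + q (\<lambda>x. h x + t * g x)"
        using V fh g by (intro sublinear_onD(1)[OF q(1)]) auto
      moreover have "(\<lambda>x. (f x + s * g x) + (h x + t * g x)) = (\<lambda>x. f x + h x + (s + t) * g x)"
        by (auto simp: algebra_simps)
      ultimately have "q (\<lambda>x. f x + h x + (s + t) * g x) - (s + t) * q g \<le> a + b"
        using st by (simp add: algebra_simps)
      then show "\<exists>c\<in>A (\<lambda>x. f x + h x). c \<le> a + b"
        unfolding A_def using st by (intro bexI[OF _ imageI[of "s + t"]]) auto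
    next
      fix f a and c :: real assume f: "f \<in> V" "0 < c" and "a \<in> A f"
      then obtain t where t: "t \<ge> 0" "a = q (\<lambda>x. f x + t * g x) - t * q g" by (auto simp: A_def)
      have "q (\<lambda>x. c * (f x + t * g x)) \<le> c * q (\<lambda>x. f x + t * g x)"
        using V f g by (intro sublinear_onD(2)[OF q(1)]) auto
      then have "q (\<lambda>x. c * f x + (c * t) * g x) - (c * t) * q g \<le> c * a"
        unfolding t(2) by (simp add: algebra_simps)
      then show "\<exists>b\<in>A (\<lambda>x. c * f x). b \<le> c * a"
        unfolding A_def using t f by (intro bexI[OF _ imageI[of "c * t"]]) auto
    qed (auto simp: A_def)
    moreover have "r f \<le> q (\<lambda>x. f x + t * g x) - t * q g" if "f \<in> V" "t \<ge> 0" for f t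
      unfolding r_def using bdd[OF that(1)] that(2) by (intro cInf_lower) (auto simp: A_def)
    note r = this
    ultimately have "r f = q f"
      using min[of r f] f r[of _ 0] by simp
    then show ?thesis
      using r[OF f, of 1] by simp
  qed
  have add: "q (\<lambda>x. f x + g x) = q f + q g" if "f \<in> V" "g \<in> V" for f g
    using super[OF that] sublinear_onD(1)[OF q(1) that] by simp
  have "q (\<lambda>x. c * f x) = c * q f" if f: "f \<in> V" for c f
  proof (cases "c \<ge> 0")
    case False
    have "q (\<lambda>x. (- c) * f x + c * f x) = q (\<lambda>x. (- c) * f x) + q (\<lambda>x. c * f x)"
      using V(2)[OF f] by (intro add)
    then show ?thesis
      using False qeq[of "- c", OF _ f] q0[OF f] by simp
  qed (use qeq f in auto)
  then show thesis
    using that q(2) add by blast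
qed

text \<open>Mazur's theorem: if \<open>G\<close> had distance at least \<open>\<delta>\<close> from
  \<open>K\<close>, a continuous linear functional would separate them by \<open>\<delta>\<close>,
  against weak convergence. The \<open>F n\<close> are only asked to lie eventually in the closure
  of \<open>K\<close>, which fits the functions \<open>lip_a (F n)\<close>.\<close>

lemma weak_limit_in_L1_closure:
  assumes conv: "L1_converges_weakly \<mu> F G"
    and K: "\<And>k. k \<in> K \<Longrightarrow> integrable \<mu> k"
    and convex: "\<And>h k t. h \<in> K \<Longrightarrow> k \<in> K \<Longrightarrow> 0 \<le> t \<Longrightarrow> t \<le> 1 \<Longrightarrow> (\<lambda>x. t * h x + (1 - t) * k x) \<in> K"
    and near: "\<forall>\<^sub>F n in sequentially. \<forall>e>0. \<exists>k\<in>K. (\<integral>x. \<bar>k x - F n x\<bar> \<partial>\<mu>) \<le> e"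
    and d: "\<delta> > 0"
  shows "\<exists>k\<in>K. (\<integral>x. \<bar>k x - G x\<bar> \<partial>\<mu>) < \<delta>"
proof (rule ccontr)
  assume "\<not> ?thesis"
  then have far: "\<delta> \<le> (\<integral>x. \<bar>k x - G x\<bar> \<partial>\<mu>)" if "k \<in> K" for k
    using that by (auto simp: not_less)
  define V where "V = {f :: 'a \<Rightarrow> real. integrable \<mu> f}"
  define N where "N = (\<lambda>f :: 'a \<Rightarrow> real. \<integral>x. \<bar>f x\<bar> \<partial>\<mu>)"
  have V: "\<And>f g. f \<in> V \<Longrightarrow> g \<in> V \<Longrightarrow> (\<lambda>x. f x + g x) \<in> V" "\<And>f c. f \<in> V \<Longrightarrow> (\<lambda>x. c * f x) \<in> V"
    by (auto simp: V_def)
  have Vm: "(\<lambda>x. - f x) \<in> V" if "f \<in> V" for f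
    using that by (simp add: V_def)
  have Vd: "(\<lambda>x. f x - g x) \<in> V" if "f \<in> V" "g \<in> V" for f g
    using that by (auto simp: V_def)
  have KV: "k \<in> V" if "k \<in> K" for k using that K by (simp add: V_def)
  have GV: "G \<in> V" and FV: "F n \<in> V" for n
    using conv by (auto simp: V_def L1_converges_weakly_def)
  have Nadd: "N (\<lambda>x. f x + g x) \<le> N f + N g" if "f \<in> V" "g \<in> V" for f g
  proof -
    have "N (\<lambda>x. f x + g x) \<le> (\<integral>x. \<bar>f x\<bar> + \<bar>g x\<bar> \<partial>\<mu>)"
      unfolding N_def using that by (intro integral_mono) (auto simp: V_def)
    also have "\<dots> = N f + N g"
      unfolding N_def using that by (intro Bochner_Integration.integral_add) (auto simp: V_def)
    finally show ?thesis .
  qed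
  have Nscale: "N (\<lambda>x. c * f x) = \<bar>c\<bar> * N f" for c f
    unfolding N_def by (simp add: abs_mult)
  have Nmin: "N (\<lambda>x. - f x) = N f" for f by (simp add: N_def)
  \<comment> \<open>A linear functional below \<open>p = Inf \<circ> A\<close> separates \<open>G\<close> from \<open>K\<close> by a gap of \<open>\<delta>\<close>.\<close>
  define A where "A = (\<lambda>f. {N (\<lambda>x. f x + t * (k x - G x)) - t * \<delta> | t k. 0 \<le> t \<and> k \<in> K})"
  obtain k0 where k0: "k0 \<in> K"
    using eventually_happens'[OF sequentially_bot near] zero_less_one by blast
  have bdd: "bdd_below (A f)" if f: "f \<in> V" for f
  proof (rule bdd_belowI[of _ "- N f"])
    fix a assume "a \<in> A f"
    then obtain t k where tk: "0 \<le> t" "k \<in> K" "a = N (\<lambda>x. f x + t * (k x - G x)) - t * \<delta>"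
      by (auto simp: A_def)
    \<comment> \<open>The distance bounds the subtracted term by a norm, which the triangle
      inequality absorbs up to \<open>N f\<close>.\<close>
    have "t * \<delta> \<le> t * N (\<lambda>x. k x - G x)"
      using far[OF tk(2)] tk(1) by (simp add: N_def mult_left_mono)
    also have "\<dots> = N (\<lambda>x. (f x + t * (k x - G x)) + (-1) * f x)"
      using tk Nscale[of t] by simp
    also have "\<dots> \<le> N (\<lambda>x. f x + t * (k x - G x)) + N (\<lambda>x. (-1) * f x)"
      using f V Vd Vm KV tk GV by (intro Nadd) auto
    finally show "- N f \<le> a"
      using tk by (simp add: Nscale Nmin)
  qed
  define p where "p = (\<lambda>f. Inf (A f))"
  have "sublinear_on V p"
    unfolding p_def
  proof (rule sublinear_on_Inf[OF _ bdd V])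
    fix f g a b assume fg: "f \<in> V" "g \<in> V" and "a \<in> A f" "b \<in> A g"
    then obtain s k t l where st: "0 \<le> s" "k \<in> K" "a = N (\<lambda>x. f x + s * (k x - G x)) - s * \<delta>"
      "0 \<le> t" "l \<in> K" "b = N (\<lambda>x. g x + t * (l x - G x)) - t * \<delta>"
      unfolding A_def by blast
    \<comment> \<open>Convexity of \<open>K\<close> enters here, with weights
      \<open>s / (s + t)\<close> and \<open>t / (s + t)\<close>; if both multiples are 0, any
      element serves.\<close>
    have "\<exists>m\<in>K. \<forall>x. (s + t) * m x = s * k x + t * l x"
    proof (cases "s + t = 0")
      case True
      then have "s = 0" "t = 0" using st by auto
      then show ?thesis using k0 by auto
    next
      case False
      have "1 - s / (s + t) = t / (s + t)"
        using False by (simp add: field_simps)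
      moreover have "0 \<le> s / (s + t)" "s / (s + t) \<le> 1"
        using st False by (auto simp: divide_le_eq_1)
      ultimately have "(\<lambda>x. s / (s + t) * k x + t / (s + t) * l x) \<in> K"
        using convex[OF st(2,5), of "s / (s + t)"] by simp
      then show ?thesis
        by (rule bexI[rotated]) (use False in \<open>simp add: distrib_left\<close>)
    qed
    then obtain m where m: "m \<in> K" "\<And>x. (s + t) * m x = s * k x + t * l x" by blast
    have "N (\<lambda>x. (f x + s * (k x - G x)) + (g x + t * (l x - G x))) \<le> (a + s * \<delta>) + (b + t * \<delta>)"
      using Nadd[of "\<lambda>x. f x + s * (k x - G x)" "\<lambda>x. g x + t * (l x - G x)"] st fg V Vd KV GV by simp
    moreover have "(f x + s * (k x - G x)) + (g x + t * (l x - G x)) = f x + g x + (s + t) * (m x - G x)" for x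
      using m(2)[of x] by (simp add: algebra_simps)
    ultimately have "N (\<lambda>x. f x + g x + (s + t) * (m x - G x)) - (s + t) * \<delta> \<le> a + b"
      by (simp add: algebra_simps)
    moreover have "N (\<lambda>x. f x + g x + (s + t) * (m x - G x)) - (s + t) * \<delta> \<in> A (\<lambda>x. f x + g x)"
      unfolding A_def using st(1,4) m(1) add_nonneg_nonneg by blast
    ultimately show "\<exists>c\<in>A (\<lambda>x. f x + g x). c \<le> a + b" by blast
  next
    fix f a and c :: real assume f: "f \<in> V" "0 < c" and "a \<in> A f"
    then obtain t k where t: "0 \<le> t" "k \<in> K" "a = N (\<lambda>x. f x + t * (k x - G x)) - t * \<delta>"
      unfolding A_def by blast
    have "N (\<lambda>x. c * (f x + t * (k x - G x))) = c * N (\<lambda>x. f x + t * (k x - G x))"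
      using f by (simp add: Nscale)
    then have "N (\<lambda>x. c * f x + (c * t) * (k x - G x)) - (c * t) * \<delta> \<le> c * a"
      unfolding t(3) by (simp add: algebra_simps)
    moreover have "N (\<lambda>x. c * f x + (c * t) * (k x - G x)) - (c * t) * \<delta> \<in> A (\<lambda>x. c * f x)"
      unfolding A_def using t f by (auto intro!: exI[of _ "c * t"])
    ultimately show "\<exists>b\<in>A (\<lambda>x. c * f x). b \<le> c * a" by blast
  qed (use k0 in \<open>auto simp: A_def\<close>)
  then obtain \<phi> where \<phi>: "\<And>f. f \<in> V \<Longrightarrow> \<phi> f \<le> p f"
    "\<And>f g. f \<in> V \<Longrightarrow> g \<in> V \<Longrightarrow> \<phi> (\<lambda>x. f x + g x) = \<phi> f + \<phi> g"
    "\<And>f c. f \<in> V \<Longrightarrow> \<phi> (\<lambda>x. c * f x) = c * \<phi> f"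
    using linear_below_sublinear[of V p] V by blast
  have ple: "p f \<le> N (\<lambda>x. f x + t * (k x - G x)) - t * \<delta>" if "f \<in> V" "0 \<le> t" "k \<in> K" for f t k
    unfolding p_def using bdd[OF that(1)] that(2,3) by (intro cInf_lower) (auto simp: A_def)
  \<comment> \<open>The choice \<open>t = 0\<close> bounds \<open>\<phi>\<close> by the norm, which
    gives continuity.\<close>
  have \<phi>N: "\<phi> f \<le> N f" if "f \<in> V" for f
    using \<phi>(1)[OF that] ple[OF that order_refl k0] by simp
  have \<phi>abs: "\<bar>\<phi> f\<bar> \<le> N f" if "f \<in> V" for f
    using \<phi>N[OF that] \<phi>N[OF V(2)[OF that], of "-1"] \<phi>(3)[OF that, of "-1"] by (simp add: Nmin)
  have \<phi>d: "\<phi> (\<lambda>x. f x - g x) = \<phi> f - \<phi> g" if "f \<in> V" "g \<in> V" for f g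
    using \<phi>(2)[OF that(1) V(2)[OF that(2)], of "-1"] \<phi>(3)[OF that(2), of "-1"] by simp
  have sep: "\<phi> G + \<delta> \<le> \<phi> k" if "k \<in> K" for k
  proof -
    \<comment> \<open>At \<open>G - k\<close> with \<open>t = 1\<close> the norm cancels and only
      \<open>- \<delta>\<close> is left: this is the gap.\<close>
    have "\<phi> (\<lambda>x. G x - k x) \<le> N (\<lambda>x. (G x - k x) + 1 * (k x - G x)) - 1 * \<delta>"
      using \<phi>(1) ple[of "\<lambda>x. G x - k x" 1 k] that Vd[OF GV KV[OF that]] order_trans by fastforce
    then show ?thesis
      using \<phi>d[OF GV KV[OF that]] by (simp add: N_def)
  qed
  have "L1_functional \<mu> \<phi>"
    unfolding L1_functional_def using \<phi> \<phi>abs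
    by (auto simp: V_def N_def intro!: exI[of _ 1])
  then have "(\<lambda>n. \<phi> (F n)) \<longlonglongrightarrow> \<phi> G"
    using conv by (simp add: L1_converges_weakly_def)
  then have "\<forall>\<^sub>F n in sequentially. \<phi> (F n) < \<phi> G + \<delta> / 2"
    by (rule order_tendstoD) (use d in simp)
  from eventually_happens'[OF sequentially_bot eventually_conj[OF this near]]
  obtain n where n: "\<phi> (F n) < \<phi> G + \<delta> / 2" "\<forall>e>0. \<exists>k\<in>K. (\<integral>x. \<bar>k x - F n x\<bar> \<partial>\<mu>) \<le> e"
    by blast
  then obtain k where k: "k \<in> K" "(\<integral>x. \<bar>k x - F n x\<bar> \<partial>\<mu>) \<le> \<delta> / 2"
    using d half_gt_zero by blast
  have "\<phi> k - \<phi> (F n) \<le> \<delta> / 2"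
    using \<phi>N[OF Vd[OF KV[OF k(1)] FV[of n]]] \<phi>d[OF KV[OF k(1)] FV[of n]] k(2) by (simp add: N_def)
  then show False
    using sep[OF k(1)] n(1) by linarith
qed

section \<open>Orthogonal projections and uniqueness of the tangential gradient\<close>

lemma orth_proj_eqI:
  assumes "subspace S" "p \<in> S" "\<And>z. z \<in> S \<Longrightarrow> orthogonal (y - p) z"
  shows "orth_proj S y = p"
  unfolding orth_proj_def
proof (rule the_equality)
  fix q assume q: "q \<in> S \<and> (\<forall>z\<in>S. orthogonal (y - q) z)"
  then have "p - q \<in> S" using assms subspace_diff by blast
  then have "(y - q) \<bullet> (p - q) = 0" "(y - p) \<bullet> (p - q) = 0"
    using q assms(3) by (auto simp: orthogonal_def)
  then have "(p - q) \<bullet> (p - q) = 0"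
    by (simp add: inner_diff_left)
  then show "q = p" by simp
qed (use assms in blast)

lemma orth_proj:
  fixes S :: "'a::euclidean_space set"
  assumes "subspace S"
  shows orth_proj_in: "orth_proj S y \<in> S"
    and orth_proj_orthogonal: "z \<in> S \<Longrightarrow> (y - orth_proj S y) \<bullet> z = 0"
proof -
  obtain p q where pq: "p \<in> span S" "\<And>w. w \<in> span S \<Longrightarrow> orthogonal q w" "y = p + q"
    using orthogonal_subspace_decomp_exists[of S y] by blast
  then have "orth_proj S y = p"
    using assms by (intro orth_proj_eqI) (auto simp: span_eq_iff[THEN iffD2])
  then show "orth_proj S y \<in> S" "z \<in> S \<Longrightarrow> (y - orth_proj S y) \<bullet> z = 0"
    using pq assms by (auto simp: span_eq_iff[THEN iffD2] orthogonal_def)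
qed

lemma orth_proj_id:
  assumes "subspace S" "y \<in> S"
  shows "orth_proj S y = y"
  using assms by (intro orth_proj_eqI) (auto simp: orthogonal_def)

lemma orth_proj_add:
  fixes S :: "'a::euclidean_space set"
  assumes "subspace S"
  shows "orth_proj S (y + z) = orth_proj S y + orth_proj S z"
proof (rule orth_proj_eqI[OF assms])
  show "orth_proj S y + orth_proj S z \<in> S"
    using assms by (intro subspace_add orth_proj_in)
  show "orthogonal (y + z - (orth_proj S y + orth_proj S z)) u" if "u \<in> S" for u
    using orth_proj_orthogonal[OF assms that, of y] orth_proj_orthogonal[OF assms that, of z]
    by (simp add: orthogonal_def inner_add_left inner_diff_left)
qed

lemma orth_proj_scale:
  fixes S :: "'a::euclidean_space set"
  assumes "subspace S"
  shows "orth_proj S (c *\<^sub>R y) = c *\<^sub>R orth_proj S y"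
proof (rule orth_proj_eqI[OF assms])
  show "c *\<^sub>R orth_proj S y \<in> S"
    using assms by (intro subspace_scale orth_proj_in)
  show "orthogonal (c *\<^sub>R y - c *\<^sub>R orth_proj S y) u" if "u \<in> S" for u
    using orth_proj_orthogonal[OF assms that, of y]
    by (simp add: orthogonal_def scaleR_diff_right[symmetric])
qed

lemma orth_proj_diff:
  fixes S :: "'a::euclidean_space set"
  assumes "subspace S"
  shows "orth_proj S (y - z) = orth_proj S y - orth_proj S z"
  using orth_proj_add[OF assms, of y "(-1) *\<^sub>R z"] orth_proj_scale[OF assms, of "-1" z] by simp

lemma inner_orth_proj:
  fixes S :: "'a::euclidean_space set"
  assumes "subspace S" "z \<in> S"
  shows "orth_proj S y \<bullet> z = y \<bullet> z"
  using orth_proj_orthogonal[OF assms, of y] by (simp add: inner_diff_left)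

lemma inner_orth_proj_commute:
  fixes S :: "'a::euclidean_space set"
  assumes "subspace S"
  shows "orth_proj S y \<bullet> z = y \<bullet> orth_proj S z"
  using inner_orth_proj[OF assms orth_proj_in[OF assms, of z], of y]
    inner_orth_proj[OF assms orth_proj_in[OF assms, of y], of z]
  by (simp add: inner_commute)

lemma norm_orth_proj_le:
  fixes S :: "'a::euclidean_space set"
  assumes "subspace S"
  shows "norm (orth_proj S y) \<le> norm y"
proof -
  have "(norm (orth_proj S y))\<^sup>2 = y \<bullet> orth_proj S y"
    using inner_orth_proj[OF assms orth_proj_in[OF assms, of y], of y] by (simp add: power2_norm_eq_inner)
  also have "\<dots> \<le> norm y * norm (orth_proj S y)"
    by (rule norm_cauchy_schwarz)
  finally show ?thesis
    by (cases "norm (orth_proj S y) = 0") (auto simp: power2_eq_square mult_le_cancel_right)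
qed

text \<open>By Pythagoras the projection is the nearest point. This links the distances in
  \<open>linear_bundle\<close> to projections.\<close>

lemma infdist_subspace:
  fixes S :: "'a::euclidean_space set"
  assumes "subspace S"
  shows "infdist y S = norm (y - orth_proj S y)"
proof (rule antisym)
  let ?p = "orth_proj S y"
  show "infdist y S \<le> norm (y - ?p)"
    using infdist_le[OF orth_proj_in[OF assms], of y y] by (simp add: dist_norm)
  have "norm (y - ?p) \<le> dist y z" if z: "z \<in> S" for z
  proof -
    have "(norm (y - z))\<^sup>2 = (norm ((y - ?p) + (?p - z)))\<^sup>2" by simp
    also have "\<dots> = (norm (y - ?p))\<^sup>2 + (norm (?p - z))\<^sup>2"
      using assms z by (intro norm_add_Pythagorean)
        (auto simp: orthogonal_def intro!: orth_proj_orthogonal subspace_diff orth_proj_in)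
    finally have "(norm (y - ?p))\<^sup>2 \<le> (norm (y - z))\<^sup>2" by simp
    then show ?thesis by (simp add: dist_norm)
  qed
  then show "norm (y - ?p) \<le> infdist y S"
    using subspace_0[OF assms] by (subst infdist_notempty) (auto intro!: cINF_greatest)
qed

section \<open>Measurability of bundles and of projections onto them\<close>

lemma linear_bundle_subspace: "linear_bundle T \<Longrightarrow> subspace (T x)"
  by (simp add: linear_bundle_def)

text \<open>A bundle is measurable through distances only. Pythagoras turns them into squared norms
  of projections, polarisation gives the matrix entries of the projection, and these give the
  coordinates of the projected field.\<close>

lemma borel_measurable_orth_proj:
  fixes T :: "'a::euclidean_space \<Rightarrow> 'a set"
  assumes T: "linear_bundle T" and u[measurable]: "u \<in> borel_measurable borel"
  shows "(\<lambda>x. orth_proj (T x) (u x)) \<in> borel_measurable borel"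
proof -
  note sub = linear_bundle_subspace[OF T]
  have [measurable]: "(\<lambda>x. infdist y (T x)) \<in> borel_measurable borel" for y
    using T by (simp add: linear_bundle_def)
  have sq: "(\<lambda>x. (norm (orth_proj (T x) y))\<^sup>2) \<in> borel_measurable borel" for y
  proof -
    have "(norm (orth_proj (T x) y))\<^sup>2 = (norm y)\<^sup>2 - (infdist y (T x))\<^sup>2" for x
    proof -
      have "(norm ((y - orth_proj (T x) y) + orth_proj (T x) y))\<^sup>2 =
          (norm (y - orth_proj (T x) y))\<^sup>2 + (norm (orth_proj (T x) y))\<^sup>2"
        by (intro norm_add_Pythagorean)
          (simp add: orthogonal_def orth_proj_orthogonal[OF sub orth_proj_in[OF sub]])
      then show ?thesis by (simp add: infdist_subspace[OF sub])
    qed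
    then show ?thesis by simp
  qed
  have [measurable]: "(\<lambda>x. y \<bullet> orth_proj (T x) z) \<in> borel_measurable borel" for y z
  proof -
    have "y \<bullet> orth_proj (T x) z =
        ((norm (orth_proj (T x) (y + z)))\<^sup>2 - (norm (orth_proj (T x) (y - z)))\<^sup>2) / 4" for x
      using inner_orth_proj[OF sub[of x] orth_proj_in[OF sub[of x], of z], of y]
      by (simp add: orth_proj_add[OF sub] orth_proj_diff[OF sub] power2_norm_eq_inner
          inner_add_left inner_add_right inner_diff_left inner_diff_right inner_commute)
    then show ?thesis
      by (simp only:) (intro borel_measurable_divide borel_measurable_diff sq borel_measurable_const)
  qed
  have "(\<lambda>x. orth_proj (T x) (u x) \<bullet> i) \<in> borel_measurable borel" for i
  proof -
    have "u x \<bullet> orth_proj (T x) i = (\<Sum>j\<in>Basis. (u x \<bullet> j) * (j \<bullet> orth_proj (T x) i))" for x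
      by (subst euclidean_inner) (simp only: inner_commute[of "orth_proj (T x) i"])
    then have "orth_proj (T x) (u x) \<bullet> i = (\<Sum>j\<in>Basis. (u x \<bullet> j) * (j \<bullet> orth_proj (T x) i))" for x
      by (simp only: inner_orth_proj_commute[OF sub])
    then show ?thesis by simp
  qed
  then show ?thesis
    by (subst borel_measurable_euclidean_space) blast
qed

lemma linear_bundle_orthogonal:
  fixes T :: "'a::euclidean_space \<Rightarrow> 'a set"
  assumes T: "linear_bundle T" and w[measurable]: "w \<in> borel_measurable borel"
    and wT: "\<And>x. w x \<in> T x"
  shows "linear_bundle (\<lambda>x. T x \<inter> {z. z \<bullet> w x = 0})"
proof -
  note sub = linear_bundle_subspace[OF T]
  have sub': "subspace (T x \<inter> {z. z \<bullet> w x = 0})" for x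
    using sub by (intro subspace_inter) (auto simp: subspace_def inner_add_left)
  \<comment> \<open>The component along \<open>w x\<close> is removed; \<open>y\<close> and its
    projection have the same inner product with \<open>w x\<close>, as \<open>w x\<close> lies in
    \<open>T x\<close>. If \<open>w x = 0\<close> the correction vanishes.\<close>
  have "orth_proj (T x \<inter> {z. z \<bullet> w x = 0}) y =
      orth_proj (T x) y - ((y \<bullet> w x) / (w x \<bullet> w x)) *\<^sub>R w x" for x y
  proof (rule orth_proj_eqI[OF sub'], goal_cases)
    case 1
    show ?case
      using sub wT by (auto simp: inner_diff_left inner_orth_proj
          intro!: subspace_diff subspace_scale orth_proj_in)
  next
    case (2 z)
    then show ?case
      using orth_proj_orthogonal[OF sub, of z x y]
      by (auto simp: orthogonal_def inner_diff_left inner_commute[of _ z] inner_diff_right)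
  qed
  then have "infdist y (T x \<inter> {z. z \<bullet> w x = 0}) =
      norm (y - (orth_proj (T x) y - ((y \<bullet> w x) / (w x \<bullet> w x)) *\<^sub>R w x))" for x y
    by (simp add: infdist_subspace[OF sub'])
  moreover have [measurable]: "(\<lambda>x. orth_proj (T x) y) \<in> borel_measurable borel" for y
    by (rule borel_measurable_orth_proj[OF T]) simp
  ultimately show ?thesis
    using sub' by (simp add: linear_bundle_def)
qed

section \<open>Bounded fields with bounded divergence\<close>

lemma integrable_inner_essentially_bounded:
  fixes u v :: "'a \<Rightarrow> 'b::euclidean_space"
  assumes u: "integrable M u" and v: "essentially_bounded M v"
  shows "integrable M (\<lambda>x. u x \<bullet> v x)"
proof -
  obtain C where C: "AE x in M. norm (v x) \<le> C" and [measurable]: "v \<in> borel_measurable M"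
    using v by (auto simp: essentially_bounded_def)
  note [measurable] = borel_measurable_integrable[OF u]
  show ?thesis
  proof (rule Bochner_Integration.integrable_bound)
    show "integrable M (\<lambda>x. norm (u x) * C)" using u by simp
    show "AE x in M. norm (u x \<bullet> v x) \<le> norm (norm (u x) * C)"
      using C
    proof eventually_elim
      case (elim x)
      have "norm (u x \<bullet> v x) \<le> norm (u x) * norm (v x)"
        using Cauchy_Schwarz_ineq2 by simp
      also have "\<dots> \<le> norm (u x) * C"
        using elim by (simp add: mult_left_mono)
      also have "\<dots> \<le> norm (norm (u x) * C)" by simp
      finally show ?case .
    qed
  qed measurable
qed

lemma integral_inner_tendsto:
  fixes u :: "nat \<Rightarrow> 'a \<Rightarrow> 'b::euclidean_space"
  assumes u: "\<And>n. integrable M (u n)" and w: "integrable M w" and v: "essentially_bounded M v"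
    and lim: "(\<lambda>n. \<integral>x. norm (u n x - w x) \<partial>M) \<longlonglongrightarrow> 0"
  shows "(\<lambda>n. \<integral>x. u n x \<bullet> v x \<partial>M) \<longlonglongrightarrow> (\<integral>x. w x \<bullet> v x \<partial>M)"
proof -
  obtain C where C: "AE x in M. norm (v x) \<le> C"
    using v by (auto simp: essentially_bounded_def)
  have "norm ((\<integral>x. u n x \<bullet> v x \<partial>M) - (\<integral>x. w x \<bullet> v x \<partial>M)) \<le> (\<integral>x. norm (u n x - w x) \<partial>M) * C" for n
  proof -
    have i: "integrable M (\<lambda>x. u n x - w x)" using u w by simp
    have "(\<integral>x. u n x \<bullet> v x \<partial>M) - (\<integral>x. w x \<bullet> v x \<partial>M) = (\<integral>x. (u n x - w x) \<bullet> v x \<partial>M)"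
      using integrable_inner_essentially_bounded[OF _ v] u w by (simp add: inner_diff_left)
    also have "norm \<dots> \<le> (\<integral>x. norm ((u n x - w x) \<bullet> v x) \<partial>M)"
      by (rule integral_norm_bound)
    also have "\<dots> \<le> (\<integral>x. norm (u n x - w x) * C \<partial>M)"
    proof (rule integral_mono_AE)
      show "integrable M (\<lambda>x. norm ((u n x - w x) \<bullet> v x))"
        using integrable_inner_essentially_bounded[OF i v] by simp
      show "integrable M (\<lambda>x. norm (u n x - w x) * C)" using i by simp
      show "AE x in M. norm ((u n x - w x) \<bullet> v x) \<le> norm (u n x - w x) * C"
        using C
      proof eventually_elim
        case (elim x)
        have "norm ((u n x - w x) \<bullet> v x) \<le> norm (u n x - w x) * norm (v x)"
          using Cauchy_Schwarz_ineq2 by simp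
        also have "\<dots> \<le> norm (u n x - w x) * C"
          using elim by (simp add: mult_left_mono)
        finally show ?case .
      qed
    qed
    finally show ?thesis by simp
  qed
  then have "(\<lambda>n. (\<integral>x. u n x \<bullet> v x \<partial>M) - (\<integral>x. w x \<bullet> v x \<partial>M)) \<longlonglongrightarrow> 0"
    by (intro Lim_null_comparison[OF _ tendsto_mult_left_zero[OF lim]]) (auto simp: eventually_sequentially)
  then show ?thesis by (simp add: LIM_zero_iff)
qed

lemma essentially_bounded_scale:
  assumes \<mu>: "radon_measure \<mu>" and \<phi>: "\<phi> \<in> Cinf_c" and v: "essentially_bounded \<mu> v"
  shows "essentially_bounded \<mu> (\<lambda>x. \<phi> x *\<^sub>R v x)"
proof -
  have sb[measurable_cong]: "sets \<mu> = sets borel" using \<mu> by (simp add: radon_measure_def)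
  have [measurable]: "\<phi> \<in> borel_measurable borel"
    by (rule borel_measurable_continuous_onI[OF Cinf_c_bounded(1)[OF \<phi>]])
  obtain A where A: "\<And>x. norm (\<phi> x) \<le> A"
    using continuous_bounded_range Cinf_c_bounded(1,2)[OF \<phi>] by blast
  obtain C where C: "AE x in \<mu>. norm (v x) \<le> C" and [measurable]: "v \<in> borel_measurable \<mu>"
    using v by (auto simp: essentially_bounded_def)
  have "AE x in \<mu>. norm (\<phi> x *\<^sub>R v x) \<le> A * C"
    using C
  proof eventually_elim
    case (elim x)
    then show ?case
      using A[of x] by (auto simp del: real_norm_def simp: real_norm_def[symmetric] intro!: mult_mono order_trans[OF norm_ge_zero])
  qed
  then show ?thesis
    unfolding essentially_bounded_def by auto
qed

text \<open>Testing the divergence \<open>g\<close> of \<open>v\<close> against the product of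
  \<open>f\<close> and \<open>\<phi>\<close> gives the product rule: the divergence of the scaled
  field is \<open>\<phi> x * g x + grad \<phi> x \<bullet> v x\<close>.\<close>

lemma D_inf_div_scale:
  assumes \<mu>: "radon_measure \<mu>" and v: "v \<in> D_inf_div \<mu>" and \<phi>: "\<phi> \<in> Cinf_c"
  shows "(\<lambda>x. \<phi> x *\<^sub>R v x) \<in> D_inf_div \<mu>"
proof -
  have sb[measurable_cong]: "sets \<mu> = sets borel" using \<mu> by (simp add: radon_measure_def)
  obtain g where vb: "essentially_bounded \<mu> v" and g: "essentially_bounded \<mu> g"
    and div: "\<And>f. f \<in> Cinf_c \<Longrightarrow> (\<integral>x. grad f x \<bullet> v x \<partial>\<mu>) = - (\<integral>x. f x * g x \<partial>\<mu>)"
    using v by (auto simp: D_inf_div_def)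
  define h where "h = (\<lambda>x. \<phi> x * g x + grad \<phi> x \<bullet> v x)"
  have "essentially_bounded \<mu> h"
  proof -
    obtain A where A: "\<And>x. norm (grad \<phi> x) \<le> A"
      using continuous_bounded_range Cinf_c_bounded(3,4)[OF \<phi>] by blast
    obtain C where C: "AE x in \<mu>. norm (v x) \<le> C" and [measurable]: "v \<in> borel_measurable \<mu>"
      using vb by (auto simp: essentially_bounded_def)
    obtain D where D: "AE x in \<mu>. norm (\<phi> x *\<^sub>R g x) \<le> D" and m: "(\<lambda>x. \<phi> x *\<^sub>R g x) \<in> borel_measurable \<mu>"
      using essentially_bounded_scale[OF \<mu> \<phi> g] by (auto simp: essentially_bounded_def)
    have [measurable]: "grad \<phi> \<in> borel_measurable borel" "(\<lambda>x. \<phi> x * g x) \<in> borel_measurable \<mu>"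
      using borel_measurable_continuous_onI[OF Cinf_c_bounded(3)[OF \<phi>]] m by auto
    have "AE x in \<mu>. norm (h x) \<le> D + A * C"
      using C D
    proof eventually_elim
      case (elim x)
      have "norm (grad \<phi> x \<bullet> v x) \<le> norm (grad \<phi> x) * norm (v x)"
        using Cauchy_Schwarz_ineq2 by simp
      also have "\<dots> \<le> A * C"
        using A[of x] elim by (intro mult_mono) (auto intro: order_trans[OF norm_ge_zero])
      finally show ?case
        using elim norm_triangle_ineq[of "\<phi> x * g x" "grad \<phi> x \<bullet> v x"] by (simp add: h_def)
    qed
    moreover have "h \<in> borel_measurable \<mu>"
      unfolding h_def by measurable
    ultimately show ?thesis by (auto simp: essentially_bounded_def)
  qed
  moreover have "(\<integral>x. grad f x \<bullet> (\<phi> x *\<^sub>R v x) \<partial>\<mu>) = - (\<integral>x. f x * h x \<partial>\<mu>)" if f: "f \<in> Cinf_c" for f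
  proof -
    have f\<phi>: "(\<lambda>x. f x * \<phi> x) \<in> Cinf_c"
      using Cinf_c_mult[OF \<phi>] Cinf_cD(1)[OF f] by blast
    have gr: "grad (\<lambda>x. f x * \<phi> x) x = f x *\<^sub>R grad \<phi> x + \<phi> x *\<^sub>R grad f x" for x
      by (rule grad_mult[OF Cinf_cD(1)[OF f] Cinf_cD(1)[OF \<phi>]])
    have fg\<phi>: "integrable \<mu> (\<lambda>x. f x *\<^sub>R grad \<phi> x)"
    proof (rule radon_integrable_continuous[OF \<mu>])
      show "continuous_on UNIV (\<lambda>x. f x *\<^sub>R grad \<phi> x)"
        using Cinf_c_bounded(1)[OF f] Cinf_c_bounded(3)[OF \<phi>] by (intro continuous_intros)
      show "bounded {x. f x *\<^sub>R grad \<phi> x \<noteq> 0}"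
        by (rule bounded_subset[OF Cinf_c_bounded(2)[OF f]]) auto
    qed
    have i1: "integrable \<mu> (\<lambda>x. grad (\<lambda>x. f x * \<phi> x) x \<bullet> v x)"
      using integrable_inner_essentially_bounded[OF Cinf_c_integrable(2)[OF \<mu> f\<phi>] vb] .
    have i2: "integrable \<mu> (\<lambda>x. f x *\<^sub>R grad \<phi> x \<bullet> v x)"
      using integrable_inner_essentially_bounded[OF fg\<phi> vb] .
    have i3: "integrable \<mu> (\<lambda>x. (f x * \<phi> x) * g x)"
      using integrable_inner_essentially_bounded[OF Cinf_c_integrable(1)[OF \<mu> f\<phi>] g] by simp
    have "(\<integral>x. grad f x \<bullet> (\<phi> x *\<^sub>R v x) \<partial>\<mu>) =
        (\<integral>x. grad (\<lambda>x. f x * \<phi> x) x \<bullet> v x - f x *\<^sub>R grad \<phi> x \<bullet> v x \<partial>\<mu>)"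
      by (simp add: gr inner_add_left)
    also have "\<dots> = - (\<integral>x. (f x * \<phi> x) * g x \<partial>\<mu>) - (\<integral>x. f x *\<^sub>R grad \<phi> x \<bullet> v x \<partial>\<mu>)"
      using i1 i2 div[OF f\<phi>] by (simp only: Bochner_Integration.integral_diff)
    also have "\<dots> = - (\<integral>x. (f x * \<phi> x) * g x + f x *\<^sub>R grad \<phi> x \<bullet> v x \<partial>\<mu>)"
      using i2 i3 by (simp only: Bochner_Integration.integral_add)
    also have "\<dots> = - (\<integral>x. f x * h x \<partial>\<mu>)"
      by (simp add: h_def algebra_simps)
    finally show ?thesis .
  qed
  ultimately show ?thesis
    using essentially_bounded_scale[OF \<mu> \<phi> vb] by (auto simp: D_inf_div_def)
qed

lemma tangent_section_eq_0:
  fixes \<mu> :: "'a::euclidean_space measure"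
  assumes \<mu>: "radon_measure \<mu>" and T: "tangent_bundle \<mu> T"
    and w: "w \<in> L1_sections \<mu> T" and orth: "\<And>v. v \<in> D_inf_div \<mu> \<Longrightarrow> AE x in \<mu>. w x \<bullet> v x = 0"
  shows "AE x in \<mu>. w x = 0"
proof -
  have sb: "sets \<mu> = sets borel" using \<mu> by (simp add: radon_measure_def)
  have lb: "linear_bundle T" and TD: "\<And>v. v \<in> D_inf_div \<mu> \<Longrightarrow> AE x in \<mu>. v x \<in> T x"
    using T by (auto simp: tangent_bundle_def carries_D_inf_div_def)
  note sub = linear_bundle_subspace[OF lb]
  have wm: "w \<in> borel_measurable borel" and wT: "AE x in \<mu>. w x \<in> T x"
    using w borel_measurable_integrable[of \<mu> w] measurable_cong_sets[OF sb refl] by (auto simp: L1_sections_def)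
  \<comment> \<open>A version of \<open>w\<close> that is tangential at every point, as the
    construction of the smaller bundle requires.\<close>
  define u where "u = (\<lambda>x. orth_proj (T x) (w x))"
  have uw: "AE x in \<mu>. u x = w x"
    using wT by eventually_elim (simp add: u_def orth_proj_id[OF sub])
  have um: "u \<in> borel_measurable borel"
    unfolding u_def by (rule borel_measurable_orth_proj[OF lb wm])
  have uT: "u x \<in> T x" for x
    unfolding u_def by (rule orth_proj_in[OF sub])
  let ?S = "\<lambda>x. T x \<inter> {z. z \<bullet> u x = 0}"
  have "carries_D_inf_div \<mu> ?S"
    unfolding carries_D_inf_div_def
  proof (intro conjI ballI)
    show "linear_bundle ?S"
      by (rule linear_bundle_orthogonal[OF lb um uT])
    fix v assume v: "v \<in> D_inf_div \<mu>"
    show "AE x in \<mu>. v x \<in> ?S x"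
      using TD[OF v] orth[OF v] uw by eventually_elim (simp add: inner_commute)
  qed
  then have "AE x in \<mu>. T x \<subseteq> ?S x"
    using T unfolding tangent_bundle_def by blast
  with uw show ?thesis
  proof eventually_elim
    case (elim x)
    then have "u x \<bullet> u x = 0" using uT by blast
    then show ?case using elim by simp
  qed
qed

lemma smooth_tangential_grad_integrable:
  fixes \<mu> :: "'a::euclidean_space measure"
  assumes \<mu>: "radon_measure \<mu>" and T: "linear_bundle T" and f: "f \<in> Cinf_c"
  shows "integrable \<mu> (smooth_tangential_grad T f)"
proof (rule Bochner_Integration.integrable_bound[OF Cinf_c_integrable(2)[OF \<mu> f]])
  have sb: "sets \<mu> = sets borel" using \<mu> by (simp add: radon_measure_def)
  have "smooth_tangential_grad T f = (\<lambda>x. orth_proj (T x) (grad f x))"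
    by (auto simp: smooth_tangential_grad_def)
  then show "smooth_tangential_grad T f \<in> borel_measurable \<mu>"
    using borel_measurable_orth_proj[OF T borel_measurable_continuous_onI[OF Cinf_c_bounded(3)[OF f]]]
    by (simp only: measurable_cong_sets[OF sb refl])
  show "AE x in \<mu>. norm (smooth_tangential_grad T f x) \<le> norm (grad f x)"
    using T by (simp add: smooth_tangential_grad_def norm_orth_proj_le linear_bundle_subspace)
qed

lemma L1_sections_diff:
  assumes "linear_bundle T" "w \<in> L1_sections \<mu> T" "w' \<in> L1_sections \<mu> T"
  shows "(\<lambda>x. w x - w' x) \<in> L1_sections \<mu> T"
proof -
  have "AE x in \<mu>. w x \<in> T x" "AE x in \<mu>. w' x \<in> T x"
    using assms by (auto simp: L1_sections_def)
  then have "AE x in \<mu>. w x - w' x \<in> T x"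
    by eventually_elim (use assms(1) linear_bundle_subspace subspace_diff in blast)
  then show ?thesis
    using assms by (simp add: L1_sections_def)
qed

lemma L1_converges_diff:
  fixes f g :: "'a \<Rightarrow> 'b::euclidean_space"
  assumes "L1_converges \<mu> F f" "L1_converges \<mu> G g"
  shows "L1_converges \<mu> (\<lambda>n x. F n x - G n x) (\<lambda>x. f x - g x)"
proof -
  have i: "integrable \<mu> (F n)" "integrable \<mu> (G n)" "integrable \<mu> f" "integrable \<mu> g" for n
    using assms by (auto simp: L1_converges_def)
  have le: "(\<integral>x. norm (F n x - G n x - (f x - g x)) \<partial>\<mu>) \<le>
      (\<integral>x. norm (F n x - f x) \<partial>\<mu>) + (\<integral>x. norm (G n x - g x) \<partial>\<mu>)" for n
  proof -
    have "(\<integral>x. norm (F n x - G n x - (f x - g x)) \<partial>\<mu>) \<le>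
        (\<integral>x. norm (F n x - f x) + norm (G n x - g x) \<partial>\<mu>)"
    proof (rule integral_mono)
      show "norm (F n x - G n x - (f x - g x)) \<le> norm (F n x - f x) + norm (G n x - g x)" for x
        using norm_triangle_ineq4[of "F n x - f x" "G n x - g x"] by (simp add: algebra_simps)
    qed (use i in auto)
    then show ?thesis using i by simp
  qed
  have lim: "(\<lambda>n. \<integral>x. norm (F n x - f x) \<partial>\<mu>) \<longlonglongrightarrow> 0" "(\<lambda>n. \<integral>x. norm (G n x - g x) \<partial>\<mu>) \<longlonglongrightarrow> 0"
    using assms by (simp_all add: L1_converges_def)
  have "(\<lambda>n. \<integral>x. norm (F n x - G n x - (f x - g x)) \<partial>\<mu>) \<longlonglongrightarrow> 0"
    by (rule Lim_null_comparison[OF always_eventually tendsto_add_zero[OF lim]])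
      (simp add: le)
  then show ?thesis using i by (simp add: L1_converges_def)
qed

text \<open>This is closability: the difference of two approximating sequences tends to 0 while its
  gradients tend to \<open>z\<close>, and integration by parts against \<open>v\<close> turns the
  first limit into a statement about the second.\<close>

lemma tangential_gradient_unique:
  fixes \<mu> :: "'a::euclidean_space measure"
  assumes \<mu>: "radon_measure \<mu>" and T: "tangent_bundle \<mu> T"
    and w: "tangential_gradient \<mu> T f w" "tangential_gradient \<mu> T f w'"
  shows "AE x in \<mu>. w x = w' x"
proof -
  have lb: "linear_bundle T" and TD: "\<And>v. v \<in> D_inf_div \<mu> \<Longrightarrow> AE x in \<mu>. v x \<in> T x"
    using T by (auto simp: tangent_bundle_def carries_D_inf_div_def)
  note sub = linear_bundle_subspace[OF lb]
  obtain F F' where F: "\<And>n. F n \<in> Cinf_c" "L1_converges \<mu> F f"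
      "L1_converges \<mu> (\<lambda>n. smooth_tangential_grad T (F n)) w"
    and F': "\<And>n. F' n \<in> Cinf_c" "L1_converges \<mu> F' f"
      "L1_converges \<mu> (\<lambda>n. smooth_tangential_grad T (F' n)) w'"
    and ws: "w \<in> L1_sections \<mu> T" "w' \<in> L1_sections \<mu> T"
    using w by (auto simp: tangential_gradient_def)
  define z where "z = (\<lambda>x. w x - w' x)"
  define D where "D = (\<lambda>n x. F n x - F' n x)"
  have D: "D n \<in> Cinf_c" for n
    unfolding D_def by (rule Cinf_c_diff[OF F(1) F'(1)])
  have zs: "z \<in> L1_sections \<mu> T"
    unfolding z_def by (rule L1_sections_diff[OF lb ws])
  have "smooth_tangential_grad T (D n) x =
      smooth_tangential_grad T (F n) x - smooth_tangential_grad T (F' n) x" for n x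
    unfolding smooth_tangential_grad_def D_def
    using grad_diff[OF Cinf_cD(1)[OF F(1)] Cinf_cD(1)[OF F'(1)]] orth_proj_diff[OF sub] by simp
  then have "(\<lambda>n. smooth_tangential_grad T (D n)) =
      (\<lambda>n x. smooth_tangential_grad T (F n) x - smooth_tangential_grad T (F' n) x)"
    by (intro ext)
  then have Dz: "L1_converges \<mu> (\<lambda>n. smooth_tangential_grad T (D n)) z"
    using L1_converges_diff[OF F(3) F'(3)] by (simp only: z_def)
  have D0: "L1_converges \<mu> D (\<lambda>x. 0)"
    using L1_converges_diff[OF F(2) F'(2)] by (simp add: D_def)
  have int0: "(\<integral>x. z x \<bullet> v x \<partial>\<mu>) = 0" if v: "v \<in> D_inf_div \<mu>" for v
  proof -
    obtain g where vb: "essentially_bounded \<mu> v" and g: "essentially_bounded \<mu> g"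
      and div: "\<And>f. f \<in> Cinf_c \<Longrightarrow> (\<integral>x. grad f x \<bullet> v x \<partial>\<mu>) = - (\<integral>x. f x * g x \<partial>\<mu>)"
      using v by (auto simp: D_inf_div_def)
    have "(\<integral>x. smooth_tangential_grad T (D n) x \<bullet> v x \<partial>\<mu>) = - (\<integral>x. D n x \<bullet> g x \<partial>\<mu>)" for n
    proof -
      have "(\<integral>x. smooth_tangential_grad T (D n) x \<bullet> v x \<partial>\<mu>) = (\<integral>x. grad (D n) x \<bullet> v x \<partial>\<mu>)"
      proof (rule integral_cong_AE)
        show "(\<lambda>x. smooth_tangential_grad T (D n) x \<bullet> v x) \<in> borel_measurable \<mu>"
          by (intro borel_measurable_integrable integrable_inner_essentially_bounded
              smooth_tangential_grad_integrable \<mu> lb D vb)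
        show "(\<lambda>x. grad (D n) x \<bullet> v x) \<in> borel_measurable \<mu>"
          by (intro borel_measurable_integrable integrable_inner_essentially_bounded
              Cinf_c_integrable \<mu> D vb)
        show "AE x in \<mu>. smooth_tangential_grad T (D n) x \<bullet> v x = grad (D n) x \<bullet> v x"
          using TD[OF v] by eventually_elim (simp add: smooth_tangential_grad_def inner_orth_proj[OF sub])
      qed
      then show ?thesis using div[OF D] by simp
    qed
    moreover have "(\<lambda>n. \<integral>x. smooth_tangential_grad T (D n) x \<bullet> v x \<partial>\<mu>) \<longlonglongrightarrow> (\<integral>x. z x \<bullet> v x \<partial>\<mu>)"
      using Dz by (intro integral_inner_tendsto vb) (auto simp: L1_converges_def)
    moreover have "(\<lambda>n. - (\<integral>x. D n x \<bullet> g x \<partial>\<mu>)) \<longlonglongrightarrow> - (\<integral>x. 0 \<bullet> g x \<partial>\<mu>)"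
      using D0 by (intro tendsto_minus integral_inner_tendsto g) (auto simp: L1_converges_def)
    ultimately show ?thesis
      using LIMSEQ_unique by fastforce
  qed
  have "AE x in \<mu>. z x = 0"
  proof (rule tangent_section_eq_0[OF \<mu> T zs])
    fix v assume v: "v \<in> D_inf_div \<mu>"
    then have vb: "essentially_bounded \<mu> v" by (simp add: D_inf_div_def)
    show "AE x in \<mu>. z x \<bullet> v x = 0"
    proof (rule fundamental_lemma[OF \<mu>])
      show "integrable \<mu> (\<lambda>x. z x \<bullet> v x)"
        using zs by (intro integrable_inner_essentially_bounded vb) (simp add: L1_sections_def)
      show "(\<integral>x. \<phi> x * (z x \<bullet> v x) \<partial>\<mu>) = 0" if "\<phi> \<in> Cinf_c" for \<phi>
        using int0[OF D_inf_div_scale[OF \<mu> v that]] by simp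
    qed
  qed
  then show ?thesis
    by eventually_elim (simp add: z_def)
qed

section \<open>Existence of the tangential gradient\<close>

text \<open>The Riesz-Fischer argument: summable increments converge absolutely almost everywhere.
  The pointwise limit is recorded because the bound of \<open>w\<close> by \<open>H\<close> passes
  through it.\<close>

lemma L1_limit_of_summable_increments:
  fixes u :: "nat \<Rightarrow> 'a \<Rightarrow> 'b::euclidean_space"
  assumes u: "\<And>k. integrable M (u k)"
    and le: "\<And>k. (\<integral>x. norm (u (Suc k) x - u k x) \<partial>M) \<le> (1 / 2) ^ k"
  obtains w where "integrable M w" "AE x in M. (\<lambda>k. u k x) \<longlonglongrightarrow> w x"
    "(\<lambda>k. \<integral>x. norm (u k x - w x) \<partial>M) \<longlonglongrightarrow> 0"
proof -
  define d where "d = (\<lambda>k x. u (Suc k) x - u k x)"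
  have d[simp]: "integrable M (d k)" for k unfolding d_def using u by simp
  note [measurable] = borel_measurable_integrable[OF d]
  have geo: "summable (\<lambda>k. (1 / 2 :: real) ^ (n + k))" for n
    by (simp add: power_add summable_mult)
  have sumI: "summable (\<lambda>k. \<integral>x. norm (d (n + k) x) \<partial>M)" for n
    by (rule summable_comparison_test'[OF geo[of n], of 0]) (use le in \<open>simp add: d_def\<close>)
  have "(\<integral>\<^sup>+x. (\<Sum>k. ennreal (norm (d k x))) \<partial>M) = (\<Sum>k. \<integral>\<^sup>+x. norm (d k x) \<partial>M)"
    by (intro nn_integral_suminf) auto
  also have "\<dots> = (\<Sum>k. ennreal (\<integral>x. norm (d k x) \<partial>M))"
    by (intro arg_cong[where f = suminf] ext nn_integral_eq_integral) auto
  finally have "(\<integral>\<^sup>+x. (\<Sum>k. ennreal (norm (d k x))) \<partial>M) \<noteq> \<infinity>"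
    using sumI[of 0] by (simp add: ennreal_suminf_neq_top)
  then have "AE x in M. (\<Sum>k. ennreal (norm (d k x))) \<noteq> \<infinity>"
    by (intro nn_integral_noteq_infinite) auto
  then have sx: "AE x in M. summable (\<lambda>k. norm (d k x))"
    by eventually_elim (auto intro: summable_suminf_not_top)
  define w where "w = (\<lambda>x. u 0 x + (\<Sum>k. d k x))"
  have wi: "integrable M w"
    unfolding w_def using u sx sumI[of 0]
    by (intro Bochner_Integration.integrable_add integrable_suminf) auto
  have tel: "u n x = u 0 x + (\<Sum>k<n. d k x)" for n x
    by (induction n) (auto simp: d_def)
  have conv: "AE x in M. (\<lambda>k. u k x) \<longlonglongrightarrow> w x"
    using sx
  proof eventually_elim
    case (elim x)
    then have "(\<lambda>n. u 0 x + (\<Sum>k<n. d k x)) \<longlonglongrightarrow> w x"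
      unfolding w_def by (intro tendsto_add tendsto_const summable_LIMSEQ) (rule summable_norm_cancel)
    then show ?case by (simp only: tel[symmetric])
  qed
  have "(\<integral>x. norm (u n x - w x) \<partial>M) \<le> 2 * (1 / 2) ^ n" for n
  proof -
    have sn: "AE x in M. summable (\<lambda>k. norm (norm (d (n + k) x)))"
      using sx
    proof eventually_elim
      case (elim x)
      then have "summable (\<lambda>k. norm (d (k + n) x))"
        by (rule summable_ignore_initial_segment)
      then show ?case by (simp add: add.commute)
    qed
    have "(\<integral>x. norm (u n x - w x) \<partial>M) \<le> (\<integral>x. (\<Sum>k. norm (d (n + k) x)) \<partial>M)"
    proof (rule integral_mono_AE)
      show "integrable M (\<lambda>x. norm (u n x - w x))" using u wi by simp
      show "integrable M (\<lambda>x. \<Sum>k. norm (d (n + k) x))"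
        using sn sumI[of n] by (intro integrable_suminf) auto
      show "AE x in M. norm (u n x - w x) \<le> (\<Sum>k. norm (d (n + k) x))"
        using sx
      proof eventually_elim
        case (elim x)
        then have "u n x - w x = - (\<Sum>k. d (k + n) x)"
          using suminf_split_initial_segment[OF summable_norm_cancel[OF elim], of n]
          unfolding w_def by (subst tel[of n]) simp
        moreover have "summable (\<lambda>k. norm (d (k + n) x))"
          using elim by (rule summable_ignore_initial_segment)
        ultimately show ?case
          using summable_norm[of "\<lambda>k. d (k + n) x"] by (simp add: add.commute)
      qed
    qed
    also have "\<dots> = (\<Sum>k. \<integral>x. norm (d (n + k) x) \<partial>M)"
      using sn sumI[of n] by (intro integral_suminf) auto
    also have "\<dots> \<le> (\<Sum>k. (1 / 2) ^ (n + k))"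
      using le by (intro suminf_le sumI geo) (simp add: d_def)
    also have "\<dots> = 2 * (1 / 2) ^ n"
      by (simp add: power_add suminf_mult suminf_geometric)
    finally show ?thesis .
  qed
  then have le2: "norm (\<integral>x. norm (u n x - w x) \<partial>M) \<le> 2 * (1 / 2) ^ n" for n
    by simp
  have "(\<lambda>n. 2 * (1 / 2 :: real) ^ n) \<longlonglongrightarrow> 0"
    by (intro tendsto_mult_right_zero LIMSEQ_realpow_zero) auto
  then have "(\<lambda>k. \<integral>x. norm (u k x - w x) \<partial>M) \<longlonglongrightarrow> 0"
    by (rule Lim_null_comparison[OF always_eventually, rotated]) (use le2 in blast)
  with wi conv show thesis by (rule that)
qed

text \<open>Mazur's theorem is applied to dominating functions, because the weak convergence at hand
  is that of \<open>lip_a (F n)\<close>, not of gradients.\<close>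

lemma smooth_strong_approx:
  fixes \<mu> :: "'a::euclidean_space measure"
  assumes \<mu>: "radon_measure \<mu>" and F: "\<And>n. F n \<in> LIP_c" and Ff: "L1_converges \<mu> F f"
    and weak: "L1_converges_weakly \<mu> (\<lambda>n. lip_a (F n)) G" and d: "\<delta> > 0"
  obtains g h where "g \<in> Cinf_c" "integrable \<mu> h" "\<And>x. norm (grad g x) \<le> h x"
    "(\<integral>x. \<bar>g x - f x\<bar> \<partial>\<mu>) \<le> \<delta>" "(\<integral>x. \<bar>h x - G x\<bar> \<partial>\<mu>) \<le> \<delta>"
proof -
  \<comment> \<open>The smooth function sits behind an existential; the weights that combine two
    \<open>h\<close> also combine their \<open>g\<close>, and both the domination and the distance
    to \<open>f\<close> survive.\<close>
  define K where "K = {h. integrable \<mu> h \<and>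
    (\<exists>g\<in>Cinf_c. (\<forall>x. norm (grad g x) \<le> h x) \<and> (\<integral>x. \<bar>g x - f x\<bar> \<partial>\<mu>) \<le> \<delta>)}"
  have Fi: "integrable \<mu> (F n)" and fi: "integrable \<mu> f" for n
    using Ff by (auto simp: L1_converges_def)
  have "\<exists>k\<in>K. (\<integral>x. \<bar>k x - G x\<bar> \<partial>\<mu>) < \<delta>"
  proof (rule weak_limit_in_L1_closure[OF weak _ _ _ d])
    show "integrable \<mu> k" if "k \<in> K" for k using that by (simp add: K_def)
  next
    fix h k and t :: real assume hk: "h \<in> K" "k \<in> K" and t: "0 \<le> t" "t \<le> 1"
    then obtain g l where g: "g \<in> Cinf_c" "\<And>x. norm (grad g x) \<le> h x" "(\<integral>x. \<bar>g x - f x\<bar> \<partial>\<mu>) \<le> \<delta>"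
      and l: "l \<in> Cinf_c" "\<And>x. norm (grad l x) \<le> k x" "(\<integral>x. \<bar>l x - f x\<bar> \<partial>\<mu>) \<le> \<delta>"
      by (auto simp: K_def)
    let ?m = "\<lambda>x. t * g x + (1 - t) * l x"
    have "?m \<in> Cinf_c"
      by (intro Cinf_c_add Cinf_c_scale g l)
    moreover have "norm (grad ?m x) \<le> t * h x + (1 - t) * k x" for x
    proof -
      have "grad ?m x = grad (\<lambda>x. t * g x) x + grad (\<lambda>x. (1 - t) * l x) x"
        by (rule grad_add[OF Cinf_cD(1)[OF Cinf_c_scale[OF g(1)]] Cinf_cD(1)[OF Cinf_c_scale[OF l(1)]]])
      also have "\<dots> = t *\<^sub>R grad g x + (1 - t) *\<^sub>R grad l x"
        by (simp only: grad_scale[OF Cinf_cD(1)[OF g(1)]] grad_scale[OF Cinf_cD(1)[OF l(1)]])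
      also have "norm \<dots> \<le> t * norm (grad g x) + (1 - t) * norm (grad l x)"
        using t by (intro norm_triangle_le) simp
      also have "\<dots> \<le> t * h x + (1 - t) * k x"
        using t g(2) l(2) by (intro add_mono mult_left_mono) auto
      finally show ?thesis .
    qed
    moreover have "(\<integral>x. \<bar>?m x - f x\<bar> \<partial>\<mu>) \<le> \<delta>"
    proof -
      have "(\<integral>x. \<bar>?m x - f x\<bar> \<partial>\<mu>) \<le> (\<integral>x. t * \<bar>g x - f x\<bar> + (1 - t) * \<bar>l x - f x\<bar> \<partial>\<mu>)"
      proof (rule integral_mono)
        fix x
        have "?m x - f x = t * (g x - f x) + (1 - t) * (l x - f x)" by (simp add: algebra_simps)
        then show "\<bar>?m x - f x\<bar> \<le> t * \<bar>g x - f x\<bar> + (1 - t) * \<bar>l x - f x\<bar>"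
          using t abs_triangle_ineq[of "t * (g x - f x)" "(1 - t) * (l x - f x)"] by (simp add: abs_mult)
      qed (use Cinf_c_integrable(1)[OF \<mu> g(1)] Cinf_c_integrable(1)[OF \<mu> l(1)] fi in auto)
      also have "\<dots> = t * (\<integral>x. \<bar>g x - f x\<bar> \<partial>\<mu>) + (1 - t) * (\<integral>x. \<bar>l x - f x\<bar> \<partial>\<mu>)"
        using Cinf_c_integrable(1)[OF \<mu> g(1)] Cinf_c_integrable(1)[OF \<mu> l(1)] fi by simp
      also have "\<dots> \<le> t * \<delta> + (1 - t) * \<delta>"
        using t g(3) l(3) by (intro add_mono mult_left_mono) auto
      finally show ?thesis by (simp add: algebra_simps)
    qed
    ultimately show "(\<lambda>x. t * h x + (1 - t) * k x) \<in> K"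
      using hk by (auto simp: K_def)
  next
    have "\<forall>\<^sub>F n in sequentially. (\<integral>x. norm (F n x - f x) \<partial>\<mu>) < \<delta> / 2"
      using Ff d by (intro order_tendstoD) (auto simp: L1_converges_def)
    then show "\<forall>\<^sub>F n in sequentially. \<forall>e>0. \<exists>k\<in>K. (\<integral>x. \<bar>k x - lip_a (F n) x\<bar> \<partial>\<mu>) \<le> e"
    proof eventually_elim
      case (elim n)
      show ?case
      proof (intro allI impI)
        fix e :: real assume "e > 0"
        \<comment> \<open>\<open>F n\<close> is within \<open>\<delta> / 2\<close> of
          \<open>f\<close>, which leaves \<open>\<delta> / 2\<close> for \<open>g\<close>; the error
          of \<open>h\<close> has to go below the arbitrary \<open>e\<close>.\<close>
        then have "min e (\<delta> / 2) > 0" using d by simp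
        then obtain g h where gh: "g \<in> Cinf_c" "integrable \<mu> h" "\<And>x. norm (grad g x) \<le> h x"
          "(\<integral>x. \<bar>g x - F n x\<bar> \<partial>\<mu>) \<le> min e (\<delta> / 2)" "(\<integral>x. \<bar>h x - lip_a (F n) x\<bar> \<partial>\<mu>) \<le> min e (\<delta> / 2)"
          using smooth_approx_lip_a[OF \<mu> F] by blast
        have "(\<integral>x. \<bar>g x - f x\<bar> \<partial>\<mu>) \<le> (\<integral>x. \<bar>g x - F n x\<bar> + \<bar>F n x - f x\<bar> \<partial>\<mu>)"
          using Cinf_c_integrable(1)[OF \<mu> gh(1)] Fi[of n] fi by (intro integral_mono) auto
        also have "\<dots> = (\<integral>x. \<bar>g x - F n x\<bar> \<partial>\<mu>) + (\<integral>x. \<bar>F n x - f x\<bar> \<partial>\<mu>)"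
          using Cinf_c_integrable(1)[OF \<mu> gh(1)] Fi[of n] fi by simp
        also have "\<dots> \<le> \<delta>" using gh(4) elim by simp
        finally have "h \<in> K" using gh by (auto simp: K_def)
        then show "\<exists>k\<in>K. (\<integral>x. \<bar>k x - lip_a (F n) x\<bar> \<partial>\<mu>) \<le> e"
          using gh(5) by (intro bexI[of _ h]) auto
      qed
    qed
  qed
  then show thesis
    using that by (force simp: K_def)
qed

text \<open>The Hilbert space with weight \<open>H\<close> stays implicit: \<open>J\<close> is its
  squared norm and \<open>B\<close> a set of fields in its ball.\<close>

lemma relaxed_slope_tangential_gradient:
  fixes \<mu> :: "'a::euclidean_space measure"
  assumes \<mu>: "radon_measure \<mu>" and T: "linear_bundle T" and f: "integrable \<mu> f"
    and H: "integrable \<mu> H" "\<And>x. 0 \<le> H x"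
    and approx: "\<And>\<delta>. \<delta> > 0 \<Longrightarrow> \<exists>g h. g \<in> Cinf_c \<and> integrable \<mu> h \<and> (\<forall>x. norm (grad g x) \<le> h x) \<and>
      (\<integral>x. \<bar>g x - f x\<bar> \<partial>\<mu>) \<le> \<delta> \<and> (\<integral>x. \<bar>h x - H x\<bar> \<partial>\<mu>) \<le> \<delta>"
  obtains w where "tangential_gradient \<mu> T f w" "AE x in \<mu>. norm (w x) \<le> H x"
proof -
  note sub = linear_bundle_subspace[OF T]
  note [measurable] = borel_measurable_integrable[OF H(1)]
  define P where "P = smooth_tangential_grad T"
  have Pi: "integrable \<mu> (P g)" if "g \<in> Cinf_c" for g
    unfolding P_def by (rule smooth_tangential_grad_integrable[OF \<mu> T that])
  have gi: "integrable \<mu> (\<lambda>x. g x - f x)" if "g \<in> Cinf_c" for g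
    using Cinf_c_integrable(1)[OF \<mu> that] f by simp
  define B where "B = {b :: 'a \<Rightarrow> 'a. b \<in> borel_measurable \<mu> \<and> (\<forall>x. norm (b x) \<le> 1)}"
  have Hb: "integrable \<mu> (\<lambda>x. H x *\<^sub>R b x)" if "b \<in> B" for b
  proof (rule Bochner_Integration.integrable_bound[OF H(1)])
    have [measurable]: "b \<in> borel_measurable \<mu>" using that by (simp add: B_def)
    show "(\<lambda>x. H x *\<^sub>R b x) \<in> borel_measurable \<mu>" by measurable
    show "AE x in \<mu>. norm (H x *\<^sub>R b x) \<le> norm (H x)"
      using that by (intro AE_I2) (simp add: B_def mult_left_le)
  qed
  have Hb2: "integrable \<mu> (\<lambda>x. H x * (norm (b x))\<^sup>2)" if "b \<in> B" for b
  proof (rule Bochner_Integration.integrable_bound[OF H(1)])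
    have [measurable]: "b \<in> borel_measurable \<mu>" using that by (simp add: B_def)
    show "(\<lambda>x. H x * (norm (b x))\<^sup>2) \<in> borel_measurable \<mu>" by measurable
    show "AE x in \<mu>. norm (H x * (norm (b x))\<^sup>2) \<le> norm (H x)"
      using that by (intro AE_I2) (simp add: B_def abs_mult mult_left_le power_le_one)
  qed
  define J where "J = (\<lambda>b :: 'a \<Rightarrow> 'a. \<integral>x. H x * (norm (b x))\<^sup>2 \<partial>\<mu>)"
  have J0: "0 \<le> J b" for b
    unfolding J_def using H(2) by (intro Bochner_Integration.integral_nonneg) simp
  have JH: "J b \<le> integral\<^sup>L \<mu> H" if "b \<in> B" for b
    unfolding J_def using that H
    by (intro integral_mono Hb2) (auto simp: B_def intro!: mult_left_le power_le_one)
  \<comment> \<open>Pairs admissible up to \<open>\<delta>\<close>: \<open>b\<close> itself need not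
    be tangential, and its product with \<open>H\<close> only approximates the projected
    gradient.\<close>
  define C where "C = (\<lambda>\<delta>. {(g, b). g \<in> Cinf_c \<and> b \<in> B \<and> (\<integral>x. \<bar>g x - f x\<bar> \<partial>\<mu>) \<le> \<delta> \<and>
    (\<integral>x. norm (P g x - H x *\<^sub>R b x) \<partial>\<mu>) \<le> \<delta>})"
  have Cne: "C \<delta> \<noteq> {}" if \<delta>: "\<delta> > 0" for \<delta>
  proof -
    obtain g h where g: "g \<in> Cinf_c" "integrable \<mu> h" "\<And>x. norm (grad g x) \<le> h x"
      "(\<integral>x. \<bar>g x - f x\<bar> \<partial>\<mu>) \<le> \<delta>" "(\<integral>x. \<bar>h x - H x\<bar> \<partial>\<mu>) \<le> \<delta>"
      using approx[OF \<delta>] by blast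
    \<comment> \<open>Where \<open>h x = 0\<close> the projected gradient vanishes too and division
      by 0 gives \<open>b x = 0\<close>, so \<open>bP\<close> holds everywhere.\<close>
    define b where "b = (\<lambda>x. (1 / h x) *\<^sub>R P g x)"
    have Ph: "norm (P g x) \<le> h x" for x
      unfolding P_def smooth_tangential_grad_def using norm_orth_proj_le[OF sub] g(3) order_trans by blast
    have h0: "0 \<le> h x" for x
      using order_trans[OF norm_ge_zero Ph] .
    have bP: "P g x = h x *\<^sub>R b x" for x
      using Ph[of x] by (cases "h x = 0") (auto simp: b_def)
    have b1: "norm (b x) \<le> 1" for x
      using Ph[of x] h0[of x] by (cases "h x = 0") (auto simp: b_def field_simps)
    have "b \<in> borel_measurable \<mu>"
      unfolding b_def using g(2) Pi[OF g(1)]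
      by (intro borel_measurable_scaleR borel_measurable_divide borel_measurable_const borel_measurable_integrable)
    then have bB: "b \<in> B" using b1 by (simp add: B_def)
    have "(\<integral>x. norm (P g x - H x *\<^sub>R b x) \<partial>\<mu>) \<le> (\<integral>x. \<bar>h x - H x\<bar> \<partial>\<mu>)"
    proof (rule integral_mono)
      show "norm (P g x - H x *\<^sub>R b x) \<le> \<bar>h x - H x\<bar>" for x
      proof -
        have "P g x - H x *\<^sub>R b x = (h x - H x) *\<^sub>R b x"
          by (simp add: bP scaleR_diff_left)
        then show ?thesis using b1[of x] by (simp add: mult_left_le)
      qed
    qed (use Pi[OF g(1)] Hb[OF bB] g(2) H in auto)
    then have "(g, b) \<in> C \<delta>"
      using g bB by (simp add: C_def)
    then show ?thesis by blast
  qed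
  have Cmid: "\<exists>g. (g, \<lambda>x. (1 / 2) *\<^sub>R (b x + b' x)) \<in> C \<delta>" if "(g, b) \<in> C \<delta>" "(g', b') \<in> C \<delta>" for g b g' b' \<delta>
  proof -
    let ?m = "\<lambda>x. 1 / 2 * g x + 1 / 2 * g' x" and ?b = "\<lambda>x. (1 / 2) *\<^sub>R (b x + b' x)"
    have g: "g \<in> Cinf_c" "b \<in> B" "(\<integral>x. \<bar>g x - f x\<bar> \<partial>\<mu>) \<le> \<delta>" "(\<integral>x. norm (P g x - H x *\<^sub>R b x) \<partial>\<mu>) \<le> \<delta>"
      and g': "g' \<in> Cinf_c" "b' \<in> B" "(\<integral>x. \<bar>g' x - f x\<bar> \<partial>\<mu>) \<le> \<delta>" "(\<integral>x. norm (P g' x - H x *\<^sub>R b' x) \<partial>\<mu>) \<le> \<delta>"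
      using that by (auto simp: C_def)
    have m: "?m \<in> Cinf_c"
      by (intro Cinf_c_add Cinf_c_scale g g')
    have Pm: "P ?m x = (1 / 2) *\<^sub>R P g x + (1 / 2) *\<^sub>R P g' x" for x
      unfolding P_def smooth_tangential_grad_def
        grad_add[OF Cinf_cD(1)[OF Cinf_c_scale[OF g(1)]] Cinf_cD(1)[OF Cinf_c_scale[OF g'(1)]]]
        grad_scale[OF Cinf_cD(1)[OF g(1)]] grad_scale[OF Cinf_cD(1)[OF g'(1)]]
        orth_proj_add[OF sub] orth_proj_scale[OF sub] ..
    have bm: "?b \<in> B"
    proof -
      have "norm (?b x) \<le> 1" for x
        using norm_triangle_ineq[of "b x" "b' x"] g(2) g'(2) unfolding B_def by (auto dest!: spec[of _ x])
      then show ?thesis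
        using g(2) g'(2) unfolding B_def
        by (auto intro!: borel_measurable_scaleR borel_measurable_add)
    qed
    have "(\<integral>x. \<bar>?m x - f x\<bar> \<partial>\<mu>) \<le> (\<integral>x. 1 / 2 * \<bar>g x - f x\<bar> + 1 / 2 * \<bar>g' x - f x\<bar> \<partial>\<mu>)"
    proof (rule integral_mono)
      show "\<bar>?m x - f x\<bar> \<le> 1 / 2 * \<bar>g x - f x\<bar> + 1 / 2 * \<bar>g' x - f x\<bar>" for x
        using abs_triangle_ineq[of "1 / 2 * (g x - f x)" "1 / 2 * (g' x - f x)"]
        by (simp add: abs_mult field_simps)
    qed (use gi[OF m] gi[OF g(1)] gi[OF g'(1)] in auto)
    also have "\<dots> = 1 / 2 * (\<integral>x. \<bar>g x - f x\<bar> \<partial>\<mu>) + 1 / 2 * (\<integral>x. \<bar>g' x - f x\<bar> \<partial>\<mu>)"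
      using gi[OF g(1)] gi[OF g'(1)] by simp
    finally have 1: "(\<integral>x. \<bar>?m x - f x\<bar> \<partial>\<mu>) \<le> \<delta>" using g(3) g'(3) by linarith
    have "(\<integral>x. norm (P ?m x - H x *\<^sub>R ?b x) \<partial>\<mu>) \<le>
        (\<integral>x. 1 / 2 * norm (P g x - H x *\<^sub>R b x) + 1 / 2 * norm (P g' x - H x *\<^sub>R b' x) \<partial>\<mu>)"
    proof (rule integral_mono)
      fix x
      have "P ?m x - H x *\<^sub>R ?b x = (1 / 2) *\<^sub>R (P g x - H x *\<^sub>R b x) + (1 / 2) *\<^sub>R (P g' x - H x *\<^sub>R b' x)"
        unfolding Pm by (simp add: algebra_simps)
      then show "norm (P ?m x - H x *\<^sub>R ?b x) \<le>
          1 / 2 * norm (P g x - H x *\<^sub>R b x) + 1 / 2 * norm (P g' x - H x *\<^sub>R b' x)"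
        using norm_triangle_ineq[of "(1 / 2) *\<^sub>R (P g x - H x *\<^sub>R b x)" "(1 / 2) *\<^sub>R (P g' x - H x *\<^sub>R b' x)"]
        by simp
    next
      show "integrable \<mu> (\<lambda>x. norm (P ?m x - H x *\<^sub>R ?b x))"
        by (intro integrable_norm Bochner_Integration.integrable_diff Pi Hb m bm)
      show "integrable \<mu> (\<lambda>x. 1 / 2 * norm (P g x - H x *\<^sub>R b x) + 1 / 2 * norm (P g' x - H x *\<^sub>R b' x))"
        by (intro Bochner_Integration.integrable_add integrable_mult_right integrable_norm
            Bochner_Integration.integrable_diff Pi Hb g g')
    qed
    also have "\<dots> = 1 / 2 * (\<integral>x. norm (P g x - H x *\<^sub>R b x) \<partial>\<mu>) + 1 / 2 * (\<integral>x. norm (P g' x - H x *\<^sub>R b' x) \<partial>\<mu>)"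
      using Pi[OF g(1)] Hb[OF g(2)] Pi[OF g'(1)] Hb[OF g'(2)] by simp
    finally have 2: "(\<integral>x. norm (P ?m x - H x *\<^sub>R ?b x) \<partial>\<mu>) \<le> \<delta>" using g(4) g'(4) by linarith
    have "(?m, ?b) \<in> C \<delta>"
      using 1 2 m bm by (simp only: C_def mem_Collect_eq prod.case)
    then show ?thesis by blast
  qed
  define \<epsilon> where "\<epsilon> = (\<lambda>k. 1 / real (Suc k))"
  have \<epsilon>: "\<epsilon> k > 0" for k by (simp add: \<epsilon>_def)
  have \<epsilon>mono: "\<epsilon> j \<le> \<epsilon> k" if "k \<le> j" for j k using that by (simp add: \<epsilon>_def frac_le)
  have \<epsilon>0: "\<epsilon> \<longlonglongrightarrow> 0"
    unfolding \<epsilon>_def using LIMSEQ_inverse_real_of_nat by (simp add: inverse_eq_divide)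
  have Cmono: "C \<delta> \<subseteq> C \<delta>'" if "\<delta> \<le> \<delta>'" for \<delta> \<delta>'
    using that by (auto simp: C_def)
  \<comment> \<open>The sets shrink as \<open>k\<close> grows, so the infima increase; they stay
    below the integral of \<open>H\<close> and therefore converge.\<close>
  define m where "m = (\<lambda>k. INF p\<in>C (\<epsilon> k). J (snd p))"
  have bddJ: "bdd_below ((\<lambda>p. J (snd p)) ` A)" for A :: "(('a \<Rightarrow> real) \<times> ('a \<Rightarrow> 'a)) set"
    by (rule bdd_belowI2[of _ 0]) (rule J0)
  have mle: "m k \<le> J b" if "(g, b) \<in> C (\<epsilon> k)" for k g b
    unfolding m_def using cINF_lower[OF bddJ that] by simp
  have "incseq m"
    unfolding m_def incseq_def using Cne[OF \<epsilon>] Cmono[OF \<epsilon>mono] bddJ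
    by (auto intro!: cINF_superset_mono)
  moreover have "m k \<le> integral\<^sup>L \<mu> H" for k
  proof -
    obtain g b where gb: "(g, b) \<in> C (\<epsilon> k)" using Cne[OF \<epsilon>[of k]] by auto
    then have "b \<in> B" by (simp add: C_def)
    then show ?thesis using mle[OF gb] JH by fastforce
  qed
  ultimately obtain L where L: "m \<longlonglongrightarrow> L" "\<And>k. m k \<le> L"
    using incseq_convergent[of m] by blast
  have "\<exists>p\<in>C (\<epsilon> k). J (snd p) < m k + \<epsilon> k" for k
    using cInf_lessD[of "(\<lambda>p. J (snd p)) ` C (\<epsilon> k)" "m k + \<epsilon> k"] Cne[OF \<epsilon>[of k]] \<epsilon>[of k]
    by (auto simp: m_def)
  then obtain p where p: "\<And>k. p k \<in> C (\<epsilon> k)" "\<And>k. J (snd (p k)) < m k + \<epsilon> k"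
    by metis
  define g where "g = (\<lambda>k. fst (p k))"
  define b where "b = (\<lambda>k. snd (p k))"
  have gb: "(g k, b k) \<in> C (\<epsilon> k)" and Jb: "J (b k) < m k + \<epsilon> k" for k
    using p by (simp_all add: g_def b_def)
  have gC: "g k \<in> Cinf_c" and bB: "b k \<in> B" and gf: "(\<integral>x. \<bar>g k x - f x\<bar> \<partial>\<mu>) \<le> \<epsilon> k"
    and gP: "(\<integral>x. norm (P (g k) x - H x *\<^sub>R b k x) \<partial>\<mu>) \<le> \<epsilon> k" for k
    using gb[of k] by (auto simp: C_def)
  \<comment> \<open>The parallelogram law bounds the energy of \<open>b j - b k\<close> by \<open>2
    * (m j + \<epsilon> j) + 2 * (m k + \<epsilon> k) - 4 * m k\<close>; now use
    \<open>m j \<le> L\<close> and \<open>\<epsilon> j \<le> \<epsilon> k\<close>.\<close>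
  define \<eta> where "\<eta> = (\<lambda>k. 2 * (L - m k) + 4 * \<epsilon> k)"
  have "\<eta> \<longlonglongrightarrow> 2 * (L - L) + 4 * 0"
    unfolding \<eta>_def by (intro tendsto_intros L \<epsilon>0)
  then have \<eta>0: "\<eta> \<longlonglongrightarrow> 0" by simp
  \<comment> \<open>Halving keeps the difference in the unit ball, so that \<open>Hb2\<close>
    applies; the factor 4 is restored in \<open>i2\<close>.\<close>
  have bdB: "(\<lambda>x. (1 / 2) *\<^sub>R (b j x - b k x)) \<in> B" for j k
  proof -
    have "norm (b j x - b k x) \<le> 2" for x
      using norm_triangle_ineq4[of "b j x" "b k x"] bB[of j] bB[of k] unfolding B_def by (auto dest!: spec[of _ x])
    then show ?thesis
      using bB[of j] bB[of k] unfolding B_def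
      by (auto intro!: borel_measurable_scaleR borel_measurable_diff)
  qed
  \<comment> \<open>Parallelogram law: both pairs lie in the convex set \<open>C (\<epsilon> k)\<close>, hence so does their midpoint,
    whose energy is at least \<open>m k\<close>.\<close>
  have energy: "(\<integral>x. H x * (norm (b j x - b k x))\<^sup>2 \<partial>\<mu>) \<le> \<eta> k" if jk: "k \<le> j" for j k
  proof -
    let ?m = "\<lambda>x. (1 / 2) *\<^sub>R (b j x + b k x)"
    have "(g j, b j) \<in> C (\<epsilon> k)"
      using gb[of j] Cmono[OF \<epsilon>mono[OF jk]] by blast
    then obtain h where h: "(h, ?m) \<in> C (\<epsilon> k)"
      using Cmid[OF _ gb] by blast
    then have mB: "?m \<in> B" by (simp add: C_def)
    have pw: "H x * (norm (b j x - b k x))\<^sup>2 = 2 * (H x * (norm (b j x))\<^sup>2) + 2 * (H x * (norm (b k x))\<^sup>2) -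
        4 * (H x * (norm (?m x))\<^sup>2)" for x
    proof -
      have "4 * (norm (?m x))\<^sup>2 = (norm (b j x + b k x))\<^sup>2"
        by (simp add: power_divide)
      moreover have "(norm (b j x - b k x))\<^sup>2 =
          2 * (norm (b j x))\<^sup>2 + 2 * (norm (b k x))\<^sup>2 - (norm (b j x + b k x))\<^sup>2"
        by (simp add: power2_norm_eq_inner inner_add_left inner_add_right inner_diff_left
            inner_diff_right inner_commute)
      ultimately have "(norm (b j x - b k x))\<^sup>2 = 2 * (norm (b j x))\<^sup>2 + 2 * (norm (b k x))\<^sup>2 - 4 * (norm (?m x))\<^sup>2"
        by linarith
      then show ?thesis
        by (simp only: right_diff_distrib distrib_left mult.left_commute[of "H x"])
    qed
    have "(\<integral>x. H x * (norm (b j x - b k x))\<^sup>2 \<partial>\<mu>) = 2 * J (b j) + 2 * J (b k) - 4 * J ?m"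
      unfolding pw J_def using Hb2[OF bB[of j]] Hb2[OF bB[of k]] Hb2[OF mB]
      by (simp only: Bochner_Integration.integral_diff Bochner_Integration.integral_add
          integral_mult_right_zero integrable_mult_right Bochner_Integration.integrable_add)
    also have "\<dots> \<le> 2 * (m j + \<epsilon> j) + 2 * (m k + \<epsilon> k) - 4 * m k"
      using Jb[of j] Jb[of k] mle[OF h]
      by (intro diff_mono add_mono mult_left_mono less_imp_le) simp_all
    also have "\<dots> \<le> \<eta> k"
      unfolding \<eta>_def using L(2)[of j] \<epsilon>mono[OF jk] by (simp add: algebra_simps)
    finally show ?thesis .
  qed
  define u where "u = (\<lambda>k x. H x *\<^sub>R b k x)"
  have ui: "integrable \<mu> (u k)" for k unfolding u_def by (rule Hb[OF bB])
  have cauchy: "\<exists>N. \<forall>k\<ge>N. \<forall>j\<ge>k. (\<integral>x. norm (u j x - u k x) \<partial>\<mu>) \<le> e" if e: "e > 0" for e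
  proof -
    let ?I = "integral\<^sup>L \<mu> H"
    \<comment> \<open>Makes the first AM-GM term at most \<open>e / 2\<close>; the 1 avoids a
      division by 0 when \<open>H\<close> has integral 0.\<close>
    define s where "s = e / (2 * (?I + 1))"
    have I0: "0 \<le> ?I" using H(2) by (simp add: Bochner_Integration.integral_nonneg)
    have s: "s > 0" "s * ?I \<le> e / 2"
      using e I0 by (auto simp: s_def field_simps)
    \<comment> \<open>AM-GM multiplies the energy by \<open>1 / (4 * s)\<close>, which turns this
      threshold into \<open>e / 2\<close>.\<close>
    have "\<forall>\<^sub>F k in sequentially. \<eta> k < 2 * s * e"
      using s e by (intro order_tendstoD[OF \<eta>0]) simp
    then obtain N where N: "\<And>k. k \<ge> N \<Longrightarrow> \<eta> k < 2 * s * e"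
      by (auto simp: eventually_sequentially)
    have "(\<integral>x. norm (u j x - u k x) \<partial>\<mu>) \<le> e" if kj: "N \<le> k" "k \<le> j" for j k
    proof -
      have i2: "integrable \<mu> (\<lambda>x. H x * (norm (b j x - b k x))\<^sup>2)"
        using integrable_mult_right[OF Hb2[OF bdB[of j k]], of 4] by (simp add: power_mult_distrib power2_eq_square)
      have "(\<integral>x. norm (u j x - u k x) \<partial>\<mu>) \<le> (\<integral>x. s * H x + 1 / (4 * s) * (H x * (norm (b j x - b k x))\<^sup>2) \<partial>\<mu>)"
      proof (rule integral_mono)
        show "norm (u j x - u k x) \<le> s * H x + 1 / (4 * s) * (H x * (norm (b j x - b k x))\<^sup>2)" for x
        proof -
          define t where "t = norm (b j x - b k x)"
          \<comment> \<open>AM-GM replaces the Cauchy-Schwarz inequality in \<open>L\<^sup>2\<close>.\<close>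
          have "0 \<le> (t - 2 * s)\<^sup>2" by simp
          then have "4 * s * t \<le> 4 * s * (s + 1 / (4 * s) * t\<^sup>2)"
            using s(1) by (simp add: power2_eq_square algebra_simps)
          then have "t \<le> s + 1 / (4 * s) * t\<^sup>2"
            using s(1) by simp
          then have "H x * t \<le> H x * (s + 1 / (4 * s) * t\<^sup>2)"
            using H(2) by (rule mult_left_mono)
          moreover have "norm (u j x - u k x) = H x * t"
            unfolding u_def t_def scaleR_diff_right[symmetric] using H(2)[of x] by simp
          ultimately show ?thesis by (simp add: t_def algebra_simps)
        qed
        show "integrable \<mu> (\<lambda>x. norm (u j x - u k x))" using ui by simp
        show "integrable \<mu> (\<lambda>x. s * H x + 1 / (4 * s) * (H x * (norm (b j x - b k x))\<^sup>2))"
          by (intro Bochner_Integration.integrable_add integrable_mult_right H i2)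
      qed
      also have "\<dots> = s * ?I + 1 / (4 * s) * (\<integral>x. H x * (norm (b j x - b k x))\<^sup>2 \<partial>\<mu>)"
        using H(1) i2 by simp
      also have "\<dots> \<le> e / 2 + 1 / (4 * s) * (2 * s * e)"
        using energy[OF kj(2)] N[OF kj(1)] s by (intro add_mono mult_left_mono) auto
      also have "\<dots> = e" using s by simp
      finally show ?thesis .
    qed
    then show ?thesis by blast
  qed
  then have "\<exists>N. \<forall>k\<ge>N. \<forall>j\<ge>k. (\<integral>x. norm (u j x - u k x) \<partial>\<mu>) \<le> (1 / 2) ^ i" for i
    by simp
  then obtain N where N: "\<And>i k j. N i \<le> k \<Longrightarrow> k \<le> j \<Longrightarrow> (\<integral>x. norm (u j x - u k x) \<partial>\<mu>) \<le> (1 / 2) ^ i"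
    by metis
  \<comment> \<open>One formula that is monotone and dominates both \<open>k\<close> and
    \<open>N k\<close>.\<close>
  define r where "r = (\<lambda>k. k + (\<Sum>i\<le>k. N i))"
  have r: "k \<le> r k" "N k \<le> r k" "r k \<le> r (Suc k)" for k
    unfolding r_def using member_le_sum[of k "{..k}" N] by auto
  obtain w where w: "integrable \<mu> w" "AE x in \<mu>. (\<lambda>k. u (r k) x) \<longlonglongrightarrow> w x"
    "(\<lambda>k. \<integral>x. norm (u (r k) x - w x) \<partial>\<mu>) \<longlonglongrightarrow> 0"
    using L1_limit_of_summable_increments[of \<mu> "\<lambda>k. u (r k)"] ui N[OF r(2,3)] by blast
  have \<epsilon>r: "\<epsilon> (r k) \<le> \<epsilon> k" for k using \<epsilon>mono r(1) by blast
  have "(\<lambda>k. \<integral>x. norm (g (r k) x - f x) \<partial>\<mu>) \<longlonglongrightarrow> 0"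
    by (rule Lim_null_comparison[OF always_eventually \<epsilon>0])
      (use gf \<epsilon>r order_trans in \<open>fastforce\<close>)
  then have 1: "L1_converges \<mu> (\<lambda>k. g (r k)) f"
    using f Cinf_c_integrable(1)[OF \<mu> gC] by (simp add: L1_converges_def)
  have Pw: "(\<integral>x. norm (P (g (r k)) x - w x) \<partial>\<mu>) \<le> \<epsilon> k + (\<integral>x. norm (u (r k) x - w x) \<partial>\<mu>)" for k
  proof -
    have "(\<integral>x. norm (P (g (r k)) x - w x) \<partial>\<mu>) \<le>
        (\<integral>x. norm (P (g (r k)) x - u (r k) x) + norm (u (r k) x - w x) \<partial>\<mu>)"
    proof (rule integral_mono)
      show "norm (P (g (r k)) x - w x) \<le> norm (P (g (r k)) x - u (r k) x) + norm (u (r k) x - w x)" for x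
        using norm_triangle_ineq[of "P (g (r k)) x - u (r k) x" "u (r k) x - w x"] by simp
    qed (use Pi[OF gC] ui w(1) in auto)
    also have "\<dots> = (\<integral>x. norm (P (g (r k)) x - u (r k) x) \<partial>\<mu>) + (\<integral>x. norm (u (r k) x - w x) \<partial>\<mu>)"
      using Pi[OF gC] ui w(1) by simp
    finally show ?thesis
      using gP[of "r k"] \<epsilon>r[of k] by (simp add: u_def)
  qed
  have Plim: "(\<lambda>k. \<integral>x. norm (P (g (r k)) x - w x) \<partial>\<mu>) \<longlonglongrightarrow> 0"
    by (rule Lim_null_comparison[OF always_eventually tendsto_add_zero[OF \<epsilon>0 w(3)]])
      (simp add: Pw)
  then have 2: "L1_converges \<mu> (\<lambda>k. P (g (r k))) w"
    using Pi[OF gC] w(1) by (simp add: L1_converges_def)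
  \<comment> \<open>The \<open>u k\<close> need not be tangential, so tangency of \<open>w\<close>
    comes from the projected gradients: a subsequence converges almost everywhere, and subspaces are
    closed.\<close>
  obtain q :: "nat \<Rightarrow> nat" where q: "AE x in \<mu>. (\<lambda>k. P (g (r (q k))) x - w x) \<longlonglongrightarrow> 0"
    using tendsto_L1_AE_subseq[OF _ Plim] Pi[OF gC] w(1) by auto
  have "AE x in \<mu>. w x \<in> T x"
    using q
  proof eventually_elim
    case (elim x)
    then have "(\<lambda>k. P (g (r (q k))) x) \<longlonglongrightarrow> w x" by (simp add: LIM_zero_iff)
    then show ?case
      by (rule closed_sequentially[OF closed_subspace[OF sub], rotated])
        (simp add: P_def smooth_tangential_grad_def orth_proj_in[OF sub])
  qed
  then have "tangential_gradient \<mu> T f w"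
    unfolding tangential_gradient_def L1_sections_def using w(1) gC 1 2 unfolding P_def
    by (auto intro!: exI[of _ "\<lambda>k. g (r k)"])
  moreover have "AE x in \<mu>. norm (w x) \<le> H x"
    using w(2)
  proof eventually_elim
    case (elim x)
    have "norm (u (r k) x) \<le> H x" for k
      using bB[of "r k"] H(2)[of x] by (simp add: u_def B_def mult_left_le)
    then show ?case
      by (intro LIMSEQ_le_const2[OF tendsto_norm[OF elim]]) auto
  qed
  ultimately show thesis by (rule that)
qed

lemma relaxed_slope_bounds_tangential_gradient:
  fixes \<mu> :: "'a::euclidean_space measure"
  assumes \<mu>: "radon_measure \<mu>" and T: "linear_bundle T" and G: "relaxed_slope \<mu> f G"
  obtains w where "tangential_gradient \<mu> T f w" "AE x in \<mu>. norm (w x) \<le> G x"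
proof -
  obtain F G' where F: "\<And>n. F n \<in> LIP_c" "L1_converges \<mu> F f"
    "L1_converges_weakly \<mu> (\<lambda>n. lip_a (F n)) G'"
    and G': "AE x in \<mu>. G' x \<le> G x" and G0: "AE x in \<mu>. 0 \<le> G x"
    using G by (auto simp: relaxed_slope_def)
  have fi: "integrable \<mu> f" and G'i: "integrable \<mu> G'"
    using F by (auto simp: L1_converges_def L1_converges_weakly_def)
  \<comment> \<open>The weight has to be nonnegative everywhere, while \<open>G'\<close> is only a
    weak limit. Since each \<open>h\<close> is nonnegative, truncation does not increase its
    distance to the target.\<close>
  define H where "H = (\<lambda>x. max 0 (G' x))"
  have H: "integrable \<mu> H" "\<And>x. 0 \<le> H x"
    using G'i by (auto simp: H_def)
  have "\<exists>g h. g \<in> Cinf_c \<and> integrable \<mu> h \<and> (\<forall>x. norm (grad g x) \<le> h x) \<and>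
      (\<integral>x. \<bar>g x - f x\<bar> \<partial>\<mu>) \<le> \<delta> \<and> (\<integral>x. \<bar>h x - H x\<bar> \<partial>\<mu>) \<le> \<delta>" if d: "\<delta> > 0" for \<delta>
  proof -
    obtain g h where g: "g \<in> Cinf_c" "integrable \<mu> h" "\<And>x. norm (grad g x) \<le> h x"
      "(\<integral>x. \<bar>g x - f x\<bar> \<partial>\<mu>) \<le> \<delta>" "(\<integral>x. \<bar>h x - G' x\<bar> \<partial>\<mu>) \<le> \<delta>"
      using smooth_strong_approx[OF \<mu> F d] by blast
    have "(\<integral>x. \<bar>h x - H x\<bar> \<partial>\<mu>) \<le> (\<integral>x. \<bar>h x - G' x\<bar> \<partial>\<mu>)"
    proof (rule integral_mono)
      show "\<bar>h x - H x\<bar> \<le> \<bar>h x - G' x\<bar>" for x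
        using order_trans[OF norm_ge_zero g(3)[of x]] by (auto simp: H_def max_def)
    qed (use g(2) H(1) G'i in auto)
    with g show ?thesis by (intro exI[of _ g] exI[of _ h]) auto
  qed
  then obtain w where w: "tangential_gradient \<mu> T f w" "AE x in \<mu>. norm (w x) \<le> H x"
    using relaxed_slope_tangential_gradient[OF \<mu> T fi H] by blast
  have "AE x in \<mu>. norm (w x) \<le> G x"
    using w(2) G' G0 by eventually_elim (auto simp: H_def)
  with w(1) show thesis by (rule that)
qed

theorem theorem5p8:
  fixes \<mu> :: "(real ^ 'n) measure" and T :: "real ^ 'n \<Rightarrow> (real ^ 'n) set"
  assumes "radon_measure \<mu>"
    and "tangent_bundle \<mu> T"
  shows "W11_Lip \<mu> \<subseteq> W11 \<mu> T \<and>
    (\<forall>f\<in>W11_Lip \<mu>. \<forall>w G. tangential_gradient \<mu> T f w \<longrightarrow> minimal_relaxed_slope \<mu> f G \<longrightarrow>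
       (AE x in \<mu>. norm (w x) \<le> G x))"
proof (intro conjI ballI allI impI subsetI)
  have T: "linear_bundle T"
    using assms(2) by (simp add: tangent_bundle_def carries_D_inf_div_def)
  fix f assume f: "f \<in> W11_Lip \<mu>"
  then obtain G where "integrable \<mu> f" "relaxed_slope \<mu> f G"
    by (auto simp: W11_Lip_def)
  then show "f \<in> W11 \<mu> T"
    using relaxed_slope_bounds_tangential_gradient[OF assms(1) T] unfolding W11_def by blast
  fix w G assume w: "tangential_gradient \<mu> T f w" and "minimal_relaxed_slope \<mu> f G"
  then obtain w' where "tangential_gradient \<mu> T f w'" "AE x in \<mu>. norm (w' x) \<le> G x"
    using relaxed_slope_bounds_tangential_gradient[OF assms(1) T]
    unfolding minimal_relaxed_slope_def by blast
  \<comment> \<open>The bound is known for the constructed \<open>w'\<close>; uniqueness carries it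
    over to the given \<open>w\<close>.\<close>
  with tangential_gradient_unique[OF assms w this(1)] show "AE x in \<mu>. norm (w x) \<le> G x"
    by auto
qed

end
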